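(* Let $n\ge1$ and let $\varphi:[0,\infty)\to[0,\infty)$ be an increasing, continuous, concave function with $\varphi(0)=0$ and $\lim_{t\to\infty}\varphi(t)=+\infty$. Then there is a finite constant $c_{\varphi,n}$, depending only on $\varphi$ and $n$, such that for any non-atomic Radon measure $\mu$ on $\mathbb{R}^n$ satisfying $\mu(\partial R)=0$ for every rectangle $R$ with sides parallel to the coordinate axes, we have $\mathrm{bmo}(\mu)=\mathrm{bmo}_\varphi(\mu)$ and, for every $\mu$-measurable $f:\mathbb{R}^n\to\mathbb{R}$, $$\varphi^{-1}(1)\,\|f\|_{\mathrm{bmo}_\varphi(\mu)}\le\|f\|_{\mathrm{bmo}(\mu)}\le c_{\varphi,n}\,\|f\|_{\mathrm{bmo}_\varphi(\mu)}.$$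
   Context: The measure $\mu$ is not assumed to be doubling. Non-atomic means that points have $\mu$-measure zero. A rectangle $R\subset\mathbb{R}^n$ is a product of $n$ bounded nondegenerate intervals (sides parallel to the coordinate axes); suprema over rectangles are taken over those with $\mu(R)>0$. Write $f_R=\frac1{\mu(R)}\int_Rf\,d\mu$. Define $$\|f\|_{\mathrm{bmo}(\mu)}=\sup_R\frac1{\mu(R)}\int_R|f-f_R|\,d\mu$$ (with value $\infty$ if $f$ is not $\mu$-integrable on every rectangle), and $$\|f\|_{\mathrm{bmo}_\varphi(\mu)}=\sup_R\inf_{c\in\mathbb{R}}\|f-c\|_{\varphi,R,\mu},\qquad \|g\|_{\varphi,R,\mu}=\inf\Big\{\lambda>0:\ \frac1{\mu(R)}\int_R\varphi\Big(\frac{|g|}{\lambda}\Big)d\mu\le1\Big\}$$ (with $\inf\emptyset=\infty$). $\mathrm{bmo}(\mu)$ and $\mathrm{bmo}_\varphi(\mu)$ ("little BMO" spaces) are the classes of $\mu$-measurable functions for which the respective quantity is finite. $\varphi^{-1}$ denotes the inverse function of $\varphi$. *)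

theory Defs
  imports "HOL-Analysis.Analysis"
begin

text \<open>The intervals may be open, closed or half-open; nondegenerate means having at least two
  points.\<close>

definition rectangle :: "(real ^ 'n) set \<Rightarrow> bool" where
  "rectangle R \<longleftrightarrow> (\<exists>I :: 'n \<Rightarrow> real set.
     (\<forall>i. is_interval (I i) \<and> bounded (I i) \<and> (\<exists>a\<in>I i. \<exists>b\<in>I i. a < b)) \<and>
     R = {x. \<forall>i. x $ i \<in> I i})"

definition radon_measure :: "'a::topological_space measure \<Rightarrow> bool" where
  "radon_measure M \<longleftrightarrow> sets M = sets borel \<and>
     (\<forall>K. compact K \<longrightarrow> emeasure M K < \<infinity>) \<and>
     (\<forall>B\<in>sets borel. emeasure M B = (SUP K\<in>{K. compact K \<and> K \<subseteq> B}. emeasure M K))"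

text \<open>A Radon measure \<open>M\<close> lives on the Borel sets, so \<open>M\<close>-measurability and integration of functions
  refer to \<open>completion M\<close>. The completion does not change the measure of a rectangle.\<close>

definition pos_rectangles :: "(real ^ 'n) measure \<Rightarrow> (real ^ 'n) set set" where
  "pos_rectangles M = {R. rectangle R \<and> 0 < emeasure M R}"

definition avg :: "(real ^ 'n) measure \<Rightarrow> (real ^ 'n) set \<Rightarrow> (real ^ 'n \<Rightarrow> real) \<Rightarrow> real" where
  "avg M R f = (1 / measure M R) * (LINT x:R|completion M. f x)"

definition bmo_norm :: "(real ^ 'n) measure \<Rightarrow> (real ^ 'n \<Rightarrow> real) \<Rightarrow> ennreal" where
  "bmo_norm M f =
     (if \<forall>R. rectangle R \<longrightarrow> set_integrable (completion M) R f
      then (SUP R\<in>pos_rectangles M.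
              (\<integral>\<^sup>+x\<in>R. ennreal \<bar>f x - avg M R f\<bar> \<partial>completion M) / emeasure M R)
      else \<infinity>)"

definition lux_norm ::
    "(real \<Rightarrow> real) \<Rightarrow> (real ^ 'n) set \<Rightarrow> (real ^ 'n) measure \<Rightarrow> (real ^ 'n \<Rightarrow> real) \<Rightarrow> ennreal" where
  "lux_norm \<phi> R M g =
     Inf {ennreal l | l :: real. 0 < l \<and>
       (\<integral>\<^sup>+x\<in>R. ennreal (\<phi> (\<bar>g x\<bar> / l)) \<partial>completion M) / emeasure M R \<le> 1}"

definition bmo_phi_norm ::
    "(real \<Rightarrow> real) \<Rightarrow> (real ^ 'n) measure \<Rightarrow> (real ^ 'n \<Rightarrow> real) \<Rightarrow> ennreal" where
  "bmo_phi_norm \<phi> M f =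
     (SUP R\<in>pos_rectangles M. INF c :: real. lux_norm \<phi> R M (\<lambda>x. f x - c))"

definition bmo :: "(real ^ 'n) measure \<Rightarrow> (real ^ 'n \<Rightarrow> real) set" where
  "bmo M = {f \<in> borel_measurable (completion M). bmo_norm M f < \<infinity>}"

definition bmo_phi :: "(real \<Rightarrow> real) \<Rightarrow> (real ^ 'n) measure \<Rightarrow> (real ^ 'n \<Rightarrow> real) set" where
  "bmo_phi \<phi> M = {f \<in> borel_measurable (completion M). bmo_phi_norm \<phi> M f < \<infinity>}"

end

theory Submission
  imports Defs "HOL-Probability.Distribution_Functions"
begin

text \<open>
  The lower estimate is Jensen's inequality, through a supporting line of \<open>\<phi>\<close> at \<open>\<phi>\<^sup>-\<^sup>1(1)\<close>.

  For the upper one, hyperplane sections of rectangles are null, so every rectangle can be bisected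
  orthogonally to any coordinate axis into two rectangles of equal measure. This replaces
  doubling: a rectangle on which the mean of \<open>h = \<phi>(|f - c\<^sub>R|)\<close> exceeds 2, while its parent's mean
  does not, has mean at most 4, hence \<open>|c\<^sub>Z - c\<^sub>R| < A\<close>, where \<open>\<phi> > 5\<close> on \<open>[A, \<infinity>)\<close>. Where no stopping
  occurs, \<open>h \<le> 4\<close> up to small measure. In place of a differentiation theorem, any Borel set is
  almost resolved by some finite tree of bisections: for a half-space bisect repeatedly in the one
  relevant coordinate, and the general case follows by closure under complements and countable unions.
  The suprema \<open>S\<^sub>N\<close> over \<open>R\<close> of the means of \<open>min(|f - c\<^sub>R|, N)\<close> then satisfy \<open>S\<^sub>N \<le> (3 A + S\<^sub>N) / 2\<close>, so
  \<open>S\<^sub>N \<le> 3 A\<close> for every \<open>N\<close>.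
\<close>

section \<open>Bisection of rectangles\<close>

lemma is_interval_borel:
  fixes I :: "real set"
  assumes "is_interval I"
  shows "I \<in> sets borel"
proof -
  have "\<exists>a b. I = {} \<or> I = UNIV \<or> I = {..<b} \<or> I = {..b} \<or> I = {a<..} \<or> I = {a..} \<or>
      I = {a<..<b} \<or> I = {a<..b} \<or> I = {a..<b} \<or> I = {a..b}"
    by (rule interval_cases) (use assms in \<open>unfold is_interval_1, blast\<close>)
  then show ?thesis by (elim exE disjE) simp_all
qed

lemma rectangle_borel:
  fixes R :: "(real ^ 'n) set"
  assumes "rectangle R"
  shows "R \<in> sets borel"
proof -
  obtain I :: "'n \<Rightarrow> real set" where
    I: "\<And>i. is_interval (I i) \<and> bounded (I i) \<and> (\<exists>a\<in>I i. \<exists>b\<in>I i. a < b)"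
    and R: "R = {x. \<forall>i. x $ i \<in> I i}"
    using assms unfolding rectangle_def by auto
  have "(\<lambda>x :: real ^ 'n. x $ i) -` I i \<inter> space borel \<in> sets borel" for i
    by (intro measurable_sets[of _ borel borel] is_interval_borel) (measurable, simp add: I)
  then have "(\<Inter>i. (\<lambda>x :: real ^ 'n. x $ i) -` I i) \<in> sets borel"
    by (intro sets.finite_INT) auto
  moreover have "(\<Inter>i. (\<lambda>x :: real ^ 'n. x $ i) -` I i) = R"
    by (auto simp: R)
  ultimately show ?thesis by simp
qed

lemma rectangle_bounded:
  fixes R :: "(real ^ 'n) set"
  assumes "rectangle R"
  shows "bounded R"
proof -
  obtain I :: "'n \<Rightarrow> real set" where
    I: "\<And>i. is_interval (I i) \<and> bounded (I i) \<and> (\<exists>a\<in>I i. \<exists>b\<in>I i. a < b)"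
    and R: "R = {x. \<forall>i. x $ i \<in> I i}"
    using assms unfolding rectangle_def by auto
  have "\<forall>i. \<exists>B. \<forall>x\<in>I i. \<bar>x\<bar> \<le> B" using I by (simp add: bounded_real)
  then obtain B where B: "\<And>i x. x \<in> I i \<Longrightarrow> \<bar>x\<bar> \<le> B i" by metis
  have "norm x \<le> sum B UNIV" if "x \<in> R" for x
    using norm_le_l1_cart[of x] sum_mono[of UNIV "\<lambda>i. \<bar>x $ i\<bar>" B] B that by (force simp: R)
  then show ?thesis unfolding bounded_iff by blast
qed

text \<open>Replacing the \<open>i\<close>-th side of \<open>R\<close> by \<open>{a..a + 1}\<close>
  gives a rectangle with the slice on its lower face. In this way the hypothesis on frontiers turns
  into nullity of hyperplane sections.\<close>

lemma slice_subset_frontier: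
  fixes R :: "(real ^ 'n) set"
  assumes "rectangle R"
  shows "\<exists>S. rectangle S \<and> R \<inter> {x. x $ i = a} \<subseteq> frontier S"
proof -
  obtain I :: "'n \<Rightarrow> real set" where
    I: "\<And>i. is_interval (I i) \<and> bounded (I i) \<and> (\<exists>a\<in>I i. \<exists>b\<in>I i. a < b)"
    and R: "R = {x. \<forall>i. x $ i \<in> I i}"
    using assms unfolding rectangle_def by auto
  define J where "J = I(i := {a..a + 1})"
  define S :: "(real ^ 'n) set" where "S = {x. \<forall>j. x $ j \<in> J j}"
  have "\<exists>b\<in>{a..a + 1}. \<exists>c\<in>{a..a + 1}. b < c"
    by (intro bexI[of _ a] bexI[of _ "a + 1"]) auto
  then have "rectangle S"
    unfolding rectangle_def S_def
    by (intro exI[of _ J]) (use I in \<open>auto simp: J_def is_interval_cc\<close>)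
  moreover have "x \<in> frontier S" if x: "x \<in> R" "x $ i = a" for x
  proof -
    have "x \<in> S" using x by (auto simp: S_def J_def R)
    moreover have "x \<notin> interior S"
    proof
      assume "x \<in> interior S"
      then obtain e where e: "e > 0" "ball x e \<subseteq> S" unfolding mem_interior by blast
      \<comment> \<open>Moving by \<open>e / 2\<close> against axis \<open>i\<close> stays in the
        ball but takes the \<open>i\<close>-th coordinate to \<open>a - e / 2\<close>, outside
        \<open>{a..a + 1}\<close>.\<close>
      have "axis i (e / 2) = (e / 2) *\<^sub>R (axis i 1 :: real ^ 'n)"
        by (simp add: vec_eq_iff axis_def)
      then have "x - axis i (e / 2) \<in> ball x e" using e(1) by (simp add: dist_norm)
      then have "(x - axis i (e / 2)) $ i \<in> J i" using e(2) unfolding S_def by blast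
      then show False using \<open>e > 0\<close> x(2) by (simp add: J_def)
    qed
    ultimately show ?thesis unfolding frontier_def using closure_subset by auto
  qed
  ultimately show ?thesis by blast
qed

section \<open>Measures that do not charge hyperplane sections of rectangles\<close>

locale null_frontier_radon =
  fixes M :: "(real ^ 'n) measure"
  assumes radon: "radon_measure M"
    and null_frontier: "rectangle R \<Longrightarrow> emeasure M (frontier R) = 0"
begin

lemma sets_M [measurable_cong]: "sets M = sets borel"
  using radon unfolding radon_measure_def by blast

lemma space_M: "space M = UNIV"
  using sets_eq_imp_space_eq[OF sets_M] by simp

lemma rectangle_sets : "rectangle R \<Longrightarrow> R \<in> sets M"
  by (simp add: rectangle_borel sets_M)

lemma rectangle_finite:
  assumes "rectangle R"
  shows "emeasure M R < \<infinity>"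
proof -
  have "compact (closure R)" using rectangle_bounded[OF assms] by (simp add: compact_closure)
  then have "emeasure M (closure R) < \<infinity>" using radon unfolding radon_measure_def by blast
  moreover have "emeasure M R \<le> emeasure M (closure R)"
    by (intro emeasure_mono closure_subset) (simp add: sets_M)
  ultimately show ?thesis by simp
qed

lemma slice_null:
  assumes "rectangle R"
  shows "emeasure M (R \<inter> {x. x $ i = a}) = 0"
proof -
  obtain S where S: "rectangle S" "R \<inter> {x. x $ i = a} \<subseteq> frontier S"
    using slice_subset_frontier[OF assms] by blast
  have "frontier S \<in> sets M" by (simp add: sets_M frontier_closed)
  then have "emeasure M (R \<inter> {x. x $ i = a}) \<le> emeasure M (frontier S)"
    by (rule emeasure_mono[OF S(2)])
  then show ?thesis
    unfolding null_frontier[OF S(1)] by simp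
qed

text \<open>The jumps of the distribution function of the projected measure are the measures of
  slices, hence zero; the intermediate value theorem then yields the level \<open>m\<close>.\<close>

lemma halving:
  assumes R: "rectangle R"
  shows "\<exists>m. emeasure M (R \<inter> {x. x $ i \<le> m}) = emeasure M R / 2"
proof -
  note [measurable] = rectangle_sets[OF R]
  have [measurable]: "(\<lambda>x. x $ i) \<in> M \<rightarrow>\<^sub>M borel" by measurable
  \<comment> \<open>\<open>\<nu>\<close> is \<open>M\<close> restricted to \<open>R\<close> and
    projected to the \<open>i\<close>-th coordinate, a finite measure on the line, so that the
    theory of \<open>cdf\<close> applies.\<close>
  define \<nu> where "\<nu> = distr (density M (indicator R)) borel (\<lambda>x. x $ i)"
  have em: "emeasure \<nu> A = emeasure M (R \<inter> {x. x $ i \<in> A})" if A[measurable]: "A \<in> sets borel" for A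
  proof -
    have "emeasure \<nu> A = emeasure (density M (indicator R)) {x. x $ i \<in> A}"
      unfolding \<nu>_def by (subst emeasure_distr) (auto simp: space_M vimage_def)
    also have "\<dots> = emeasure M (R \<inter> {x. x $ i \<in> A})"
      by (subst emeasure_density)
         (auto simp: indicator_inter_arith[symmetric] simp flip: nn_integral_indicator intro!: nn_integral_cong)
    finally show ?thesis .
  qed
  have [simp]: "space \<nu> = UNIV" by (simp add: \<nu>_def)
  have top: "emeasure \<nu> UNIV = emeasure M R" using em[of UNIV] by simp
  interpret finite_borel_measure \<nu>
  proof (intro finite_borel_measure.intro finite_measureI finite_borel_measure_axioms.intro)
    show "emeasure \<nu> (space \<nu>) \<noteq> \<infinity>" using top rectangle_finite[OF R] by simp
    show "sets \<nu> = sets borel" by (simp add: \<nu>_def)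
  qed
  have cont: "isCont (cdf \<nu>) x" for x
    unfolding isCont_cdf measure_def using em[of "{x}"] slice_null[OF R, of i x] by simp
  show ?thesis
  \<comment> \<open>Half the mass lies strictly between the limits of the distribution function only
    if \<open>R\<close> has positive measure; for a null rectangle any level will do.\<close>
  proof (cases "emeasure M R = 0")
    case True
    have "emeasure M (R \<inter> {x. x $ i \<le> 0}) \<le> emeasure M R" by (intro emeasure_mono) auto
    then show ?thesis using True by (intro exI[of _ 0]) simp
  next
    case False
    define r where "r = measure M R"
    have r': "emeasure M R = ennreal r"
      using rectangle_finite[OF R] unfolding r_def by (intro emeasure_eq_ennreal_measure) auto
    with False have r: "r > 0" by (metis ennreal_eq_0_iff not_le)
    have "(cdf \<nu> \<longlongrightarrow> r) at_top"
      using cdf_lim_at_top top by (simp add: r_def measure_def)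
    then have "eventually (\<lambda>x. cdf \<nu> x > r / 2) at_top"
      using r by (intro order_tendstoD) auto
    then obtain b where b: "cdf \<nu> b > r / 2" unfolding eventually_at_top_linorder by blast
    have "eventually (\<lambda>x. cdf \<nu> x < r / 2) at_bot"
      using r by (intro order_tendstoD[OF cdf_lim_at_bot]) auto
    then obtain a where a: "cdf \<nu> a < r / 2" unfolding eventually_at_bot_linorder by blast
    have "a \<le> b" using a b cdf_nondecreasing[of b a] by linarith
    then obtain m where m: "cdf \<nu> m = r / 2"
      using IVT[of "cdf \<nu>" a "r / 2" b] a b cont by auto
    have "emeasure M (R \<inter> {x. x $ i \<le> m}) = emeasure \<nu> {..m}"
      using em[of "{..m}"] by simp
    also have "\<dots> = ennreal (r / 2)"
      using m[unfolded cdf_def] by (simp only: emeasure_eq_measure)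
    also have "\<dots> = emeasure M R / 2"
      using r r' by (simp add: ennreal_divide_numeral)
    finally show ?thesis by blast
  qed
qed

end

section \<open>Trees of bisections\<close>

text \<open>Only the axis of each cut is stored. Its position is always a median of the current
  cell, so one tree can be run on any rectangle of positive measure.\<close>

datatype 'n bisection = Leaf | Bisect 'n "'n bisection" "'n bisection"

text \<open>If one of the minima on the right is its first argument, it already dominates
  \<open>e\<close>; otherwise the two sum to \<open>b + d\<close>, which dominates \<open>f\<close>.
  This is the leaf case for intersections of sets, with \<open>e\<close> the mass inside and
  \<open>f\<close> the mass outside.\<close>

lemma min_inter_le:
  fixes a b c d :: ennreal
  assumes "e \<le> a" "e \<le> c" "f \<le> b + d"
  shows "min e f \<le> min a b + min c d"
proof -
  consider "a \<le> b" | "c \<le> d" | "b \<le> a" "d \<le> c" using linear by blast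
  then show ?thesis
  proof cases
    case 1
    then show ?thesis using assms(1) by (simp add: min.absorb1 min.coboundedI1 add_increasing2)
  next
    case 2
    then show ?thesis using assms(2) by (simp add: min.absorb1 min.coboundedI1 add_increasing)
  next
    case 3
    then show ?thesis using assms(3) by (simp add: min.absorb2 min.coboundedI2)
  qed
qed

section \<open>Halves of a rectangle and approximation of sets by finite trees\<close>

context null_frontier_radon
begin

definition median :: "'n \<Rightarrow> (real ^ 'n) set \<Rightarrow> real" where
  "median i R = (SOME m. emeasure M (R \<inter> {x. x $ i \<le> m}) = emeasure M R / 2)"

text \<open>The cutting hyperplane is given to this half, so that the two halves partition
  \<open>R\<close> exactly and not merely up to a null set.\<close>

definition lower :: "'n \<Rightarrow> (real ^ 'n) set \<Rightarrow> (real ^ 'n) set" where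
  "lower i R = R \<inter> {x. x $ i \<le> median i R}"

definition upper :: "'n \<Rightarrow> (real ^ 'n) set \<Rightarrow> (real ^ 'n) set" where
  "upper i R = R \<inter> {x. median i R < x $ i}"

lemma lower_Un_upper: "lower i R \<union> upper i R = R"
  and lower_Int_upper: "lower i R \<inter> upper i R = {}"
  by (auto simp: lower_def upper_def)

lemma Compl_sets: "E \<in> sets M \<Longrightarrow> - E \<in> sets M"
  using sets.compl_sets[of E M] by (simp add: space_M Compl_eq_Diff_UNIV)

lemma pos_rectangles_sets: "R \<in> pos_rectangles M \<Longrightarrow> R \<in> sets M"
  by (simp add: pos_rectangles_def rectangle_sets)

text \<open>Only nondegeneracy of the shortened side is at stake: were it reduced to at most one
  point, the intersection would lie in a slice and be null.\<close>

lemma pos_rectangles_Int_interval: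
  assumes R: "R \<in> pos_rectangles M" and J: "is_interval J"
    and pos: "emeasure M (R \<inter> {x. x $ i \<in> J}) \<noteq> 0"
  shows "R \<inter> {x. x $ i \<in> J} \<in> pos_rectangles M"
proof -
  have rect: "rectangle R" using R by (simp add: pos_rectangles_def)
  then obtain I :: "'n \<Rightarrow> real set" where
    I: "\<And>i. is_interval (I i) \<and> bounded (I i) \<and> (\<exists>a\<in>I i. \<exists>b\<in>I i. a < b)"
    and RI: "R = {x. \<forall>i. x $ i \<in> I i}"
    unfolding rectangle_def by auto
  define I' where "I' = I(i := I i \<inter> J)"
  have RI': "R \<inter> {x. x $ i \<in> J} = {x. \<forall>j. x $ j \<in> I' j}"
    unfolding RI I'_def by auto
  have "\<exists>a\<in>I i \<inter> J. \<exists>b\<in>I i \<inter> J. a < b"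
  proof (rule ccontr)
    assume no: "\<not> ?thesis"
    have "R \<inter> {x. x $ i \<in> J} \<noteq> {}" using pos by (metis emeasure_empty)
    then obtain y where y: "y \<in> R" "y $ i \<in> J" by auto
    have "R \<inter> {x. x $ i \<in> J} \<subseteq> R \<inter> {x. x $ i = y $ i}"
    proof
      fix x assume "x \<in> R \<inter> {x. x $ i \<in> J}"
      then have x: "x \<in> R" "x $ i \<in> J" by auto
      have "x $ i \<in> I i \<inter> J" "y $ i \<in> I i \<inter> J" using x y by (simp_all add: RI)
      then have "\<not> x $ i < y $ i" "\<not> y $ i < x $ i" using no by blast+
      then show "x \<in> R \<inter> {x. x $ i = y $ i}" using x(1) by simp
    qed
    moreover have "{x. x $ i = y $ i} \<in> sets M" by measurable
    then have "R \<inter> {x. x $ i = y $ i} \<in> sets M" using rectangle_sets[OF rect] by (rule sets.Int[rotated])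
    ultimately have "emeasure M (R \<inter> {x. x $ i \<in> J}) \<le> emeasure M (R \<inter> {x. x $ i = y $ i})"
      by (rule emeasure_mono)
    then show False using pos unfolding slice_null[OF rect] by simp
  qed
  then have "rectangle (R \<inter> {x. x $ i \<in> J})"
    unfolding rectangle_def RI' using I J
    by (intro exI[of _ I']) (simp add: I'_def is_interval_Int bounded_Int)
  then show ?thesis using pos by (simp add: pos_rectangles_def zero_less_iff_neq_zero)
qed

text \<open>The measure of the upper half follows by subtraction, as \<open>R\<close> has finite
  measure. Both halves then have positive measure, which in turn makes them nondegenerate.\<close>

lemma
  assumes R: "R \<in> pos_rectangles M"
  shows emeasure_lower: "emeasure M (lower i R) = emeasure M R / 2"
    and emeasure_upper: "emeasure M (upper i R) = emeasure M R / 2"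
    and lower_in: "lower i R \<in> pos_rectangles M"
    and upper_in: "upper i R \<in> pos_rectangles M"
proof -
  have rect: "rectangle R" and pos: "emeasure M R \<noteq> 0" using R by (auto simp: pos_rectangles_def)
  note [measurable] = rectangle_sets[OF rect]
  have [measurable]: "lower i R \<in> sets M" "upper i R \<in> sets M"
    unfolding lower_def upper_def by measurable
  show l: "emeasure M (lower i R) = emeasure M R / 2"
    unfolding lower_def median_def by (rule someI_ex[OF halving[OF rect]])
  obtain r where r: "r \<ge> 0" "emeasure M R = ennreal r"
    using rectangle_finite[OF rect] by (cases "emeasure M R") auto
  have half: "emeasure M R / 2 = ennreal (r / 2)"
    using r by (simp add: ennreal_divide_numeral)
  have "upper i R = R - lower i R" by (auto simp: lower_def upper_def)
  then have "emeasure M (upper i R) = emeasure M R - emeasure M (lower i R)"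
    using l half emeasure_Diff[of M "lower i R" R] \<open>lower i R \<in> sets M\<close> rectangle_sets[OF rect]
    by (simp add: lower_def)
  also have "\<dots> = emeasure M R / 2"
    unfolding l half unfolding r(2) using r(1) by (simp add: ennreal_minus)
  finally show u: "emeasure M (upper i R) = emeasure M R / 2" .
  have nz: "emeasure M R / 2 \<noteq> 0" using pos r unfolding half by (auto simp: ennreal_eq_0_iff)
  show "lower i R \<in> pos_rectangles M"
    using pos_rectangles_Int_interval[OF R, of "{..median i R}" i] l nz
    by (simp add: lower_def is_interval_ic)
  show "upper i R \<in> pos_rectangles M"
    using pos_rectangles_Int_interval[OF R, of "{median i R<..}" i] u nz
    by (simp add: upper_def is_interval_io)
qed

lemma emeasure_halves:
  assumes "R \<in> pos_rectangles M"
  shows "emeasure M (lower i R) + emeasure M (upper i R) = emeasure M R"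
proof -
  have "lower i R \<in> sets M" "upper i R \<in> sets M"
    using lower_in[OF assms] upper_in[OF assms] by (simp_all add: pos_rectangles_sets)
  then show ?thesis
    using plus_emeasure[of "lower i R" M "upper i R"] by (simp add: lower_Un_upper lower_Int_upper)
qed

lemma emeasure_Int_halves:
  assumes R: "R \<in> pos_rectangles M" and E: "E \<in> sets M"
  shows "emeasure M (lower i R \<inter> E) + emeasure M (upper i R \<inter> E) = emeasure M (R \<inter> E)"
proof -
  have "lower i R \<inter> E \<in> sets M" "upper i R \<inter> E \<in> sets M"
    using lower_in[OF R] upper_in[OF R] E by (simp_all add: pos_rectangles_sets sets.Int)
  moreover have "lower i R \<inter> E \<union> upper i R \<inter> E = R \<inter> E"
    and "(lower i R \<inter> E) \<inter> (upper i R \<inter> E) = {}"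
    using lower_Un_upper[of i R] lower_Int_upper[of i R] by blast+
  ultimately show ?thesis
    using plus_emeasure[of "lower i R \<inter> E" M "upper i R \<inter> E"] by simp
qed

text \<open>The total mass of the minority parts in the leaf cells, that is, the least measure of
  the symmetric difference between \<open>R \<inter> E\<close> and a union of leaf cells.\<close>

primrec defect :: "(real ^ 'n) set \<Rightarrow> 'n bisection \<Rightarrow> (real ^ 'n) set \<Rightarrow> ennreal" where
  "defect E Leaf R = min (emeasure M (R \<inter> E)) (emeasure M (R \<inter> - E))"
| "defect E (Bisect i s t) R = defect E s (lower i R) + defect E t (upper i R)"

text \<open>Asking for resolution inside every rectangle lets one tree be refined at its leaves to resolve a
  second set.\<close>

definition resolvable :: "(real ^ 'n) set \<Rightarrow> bool" where
  "resolvable E \<longleftrightarrow>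
     (\<forall>R\<in>pos_rectangles M. \<forall>e>0. \<exists>t. defect E t R \<le> ennreal e)"

text \<open>The minimum of two sums is at least the sum of the two minima, so cutting a cell further
  never increases the error.\<close>

lemma defect_le_Leaf:
  assumes "E \<in> sets M" "R \<in> pos_rectangles M"
  shows "defect E t R \<le> defect E Leaf R"
  using assms(2)
proof (induction t arbitrary: R)
  case (Bisect i s t)
  have "defect E (Bisect i s t) R \<le> defect E Leaf (lower i R) + defect E Leaf (upper i R)"
    using Bisect.IH lower_in upper_in Bisect.prems by (simp del: defect.simps(1) add: add_mono)
  also have "\<dots> \<le> min (emeasure M (lower i R \<inter> E) + emeasure M (upper i R \<inter> E))
      (emeasure M (lower i R \<inter> - E) + emeasure M (upper i R \<inter> - E))"
    by (simp add: add_mono)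
  also have "\<dots> = defect E Leaf R"
    using emeasure_Int_halves Bisect.prems assms(1) Compl_sets[OF assms(1)] by simp
  finally show ?case .
qed simp

lemma defect_Compl: "defect (- E) t R = defect E t R"
  by (induction t arbitrary: R) (simp_all add: min.commute)

lemma resolvable_Compl: "resolvable E \<Longrightarrow> resolvable (- E)"
  by (simp add: resolvable_def defect_Compl)

text \<open>The same tree serves both sets: in each leaf cell \<open>min_inter_le\<close> applies,
  and the bounds add up over the cells.\<close>

lemma defect_Int:
  assumes "E \<in> sets M" "F \<in> sets M" and "R \<in> pos_rectangles M"
  shows "defect (E \<inter> F) t R \<le> defect E t R + defect F t R"
  using assms(3)
proof (induction t arbitrary: R)
  case Leaf
  note sets = assms(1,2)[THEN Compl_sets] assms(1,2) pos_rectangles_sets[OF Leaf]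
  have "R \<inter> - (E \<inter> F) = (R \<inter> - E) \<union> (R \<inter> - F)" by blast
  then have "emeasure M (R \<inter> - (E \<inter> F)) \<le> emeasure M (R \<inter> - E) + emeasure M (R \<inter> - F)"
    using emeasure_subadditive[of "R \<inter> - E" M "R \<inter> - F"] sets by (simp add: sets.Int)
  moreover have "emeasure M (R \<inter> (E \<inter> F)) \<le> emeasure M (R \<inter> E)"
    "emeasure M (R \<inter> (E \<inter> F)) \<le> emeasure M (R \<inter> F)"
    using sets by (auto intro!: emeasure_mono)
  ultimately show ?case
    unfolding defect.simps by (intro min_inter_le)
next
  case (Bisect i s t)
  then show ?case
    using add_mono[OF Bisect.IH(1)[of "lower i R"] Bisect.IH(2)[of "upper i R"]] lower_in upper_in
    by (simp add: ac_simps)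
qed

text \<open>A tree resolving \<open>F\<close> is grafted onto every leaf of \<open>s\<close>. The
  budget \<open>e\<close> is halved at each branching of \<open>s\<close>, and by
  \<open>defect_le_Leaf\<close> the grafts do not worsen the error for \<open>E\<close>.\<close>

lemma resolvable_refine:
  assumes F: "resolvable F" and E: "E \<in> sets M" and R: "R \<in> pos_rectangles M" and e: "e > 0"
  shows "\<exists>t. defect F t R \<le> ennreal e \<and> defect E t R \<le> defect E s R"
  using R e
proof (induction s arbitrary: R e)
  case Leaf
  then obtain t where "defect F t R \<le> ennreal e" using F unfolding resolvable_def by blast
  then show ?case using defect_le_Leaf[OF E Leaf(1), of t] by blast
next
  case (Bisect i s1 s2)
  obtain t1 where t1: "defect F t1 (lower i R) \<le> ennreal (e / 2)" "defect E t1 (lower i R) \<le> defect E s1 (lower i R)"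
    using Bisect.IH(1)[of "lower i R" "e / 2"] Bisect.prems lower_in by auto
  obtain t2 where t2: "defect F t2 (upper i R) \<le> ennreal (e / 2)" "defect E t2 (upper i R) \<le> defect E s2 (upper i R)"
    using Bisect.IH(2)[of "upper i R" "e / 2"] Bisect.prems upper_in by auto
  have "ennreal (e / 2) + ennreal (e / 2) = ennreal e"
    using Bisect.prems(2) by (simp flip: ennreal_plus)
  then show ?case
    using add_mono[OF t1(1) t2(1)] add_mono[OF t1(2) t2(2)]
    by (intro exI[of _ "Bisect i t1 t2"]) simp
qed

lemma resolvable_Int:
  assumes E: "resolvable E" "E \<in> sets M" and F: "resolvable F" "F \<in> sets M"
  shows "resolvable (E \<inter> F)"
  unfolding resolvable_def
proof (intro ballI allI impI)
  fix R and e :: real assume R: "R \<in> pos_rectangles M" and e: "e > 0"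
  obtain s where s: "defect E s R \<le> ennreal (e / 2)"
    using E(1) R e unfolding resolvable_def by (meson half_gt_zero)
  obtain t where t: "defect F t R \<le> ennreal (e / 2)" "defect E t R \<le> defect E s R"
    using resolvable_refine[OF F(1) E(2) R, of "e / 2"] e by auto
  have "defect (E \<inter> F) t R \<le> defect E t R + defect F t R"
    by (rule defect_Int[OF E(2) F(2) R])
  also have "\<dots> \<le> ennreal (e / 2) + ennreal (e / 2)"
    using s t by (intro add_mono) auto
  also have "\<dots> = ennreal e" using e by (simp flip: ennreal_plus)
  finally show "\<exists>t. defect (E \<inter> F) t R \<le> ennreal e" by blast
qed

text \<open>Enlarging the set moves the mass of \<open>F - E\<close> from outside to inside, which
  changes each leaf minimum by at most the mass moved. This controls the passage from finite unions
  to countable ones.\<close>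

lemma defect_subset:
  assumes "E \<in> sets M" "F \<in> sets M" and "E \<subseteq> F" "R \<in> pos_rectangles M"
  shows "defect F t R \<le> defect E t R + emeasure M (R \<inter> (F - E))"
  using assms(4)
proof (induction t arbitrary: R)
  case Leaf
  note sets = assms(1,2)[THEN Compl_sets] assms(1,2) pos_rectangles_sets[OF Leaf]
  have "R \<inter> F = (R \<inter> E) \<union> (R \<inter> (F - E))" using \<open>E \<subseteq> F\<close> by blast
  then have "emeasure M (R \<inter> F) \<le> emeasure M (R \<inter> E) + emeasure M (R \<inter> (F - E))"
    using emeasure_subadditive[of "R \<inter> E" M "R \<inter> (F - E)"] sets by (simp add: sets.Int sets.Diff)
  moreover have "emeasure M (R \<inter> - F) \<le> emeasure M (R \<inter> - E) + emeasure M (R \<inter> (F - E))"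
    using \<open>E \<subseteq> F\<close> sets by (intro add_increasing2 emeasure_mono) auto
  ultimately show ?case
    unfolding defect.simps
    by (cases "emeasure M (R \<inter> E) \<le> emeasure M (R \<inter> - E)")
       (auto simp: min.absorb1 min.absorb2 min.coboundedI1 min.coboundedI2 not_le)
next
  case (Bisect i s t)
  have "defect F (Bisect i s t) R \<le> (defect E s (lower i R) + emeasure M (lower i R \<inter> (F - E))) +
      (defect E t (upper i R) + emeasure M (upper i R \<inter> (F - E)))"
    using Bisect.IH lower_in upper_in Bisect.prems by (simp add: add_mono)
  also have "\<dots> = defect E (Bisect i s t) R + emeasure M (R \<inter> (F - E))"
    using emeasure_Int_halves[OF Bisect.prems sets.Diff[OF assms(2,1)], of i] by (simp add: ac_simps)
  finally show ?case .
qed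

text \<open>The finite partial unions exhaust the whole union; since \<open>R\<close> has finite
  measure, continuity from above makes the remaining mass in \<open>R\<close> small. A tree for a
  late partial union then suffices.\<close>

lemma resolvable_UN:
  fixes E :: "nat \<Rightarrow> (real ^ 'n) set"
  assumes E: "\<And>n. resolvable (E n)" "\<And>n. E n \<in> sets M"
  shows "resolvable (\<Union>n. E n)"
  unfolding resolvable_def
proof (intro ballI allI impI)
  fix R and e :: real assume R: "R \<in> pos_rectangles M" and e: "e > 0"
  \<comment> \<open>The partial union is written through complements, so that closure under
    complements and binary intersections covers it.\<close>
  define F where "F n = - (\<Inter>k\<le>n. - E k)" for n
  have F: "resolvable (F n) \<and> F n \<in> sets M" for n
  proof -
    have "resolvable (\<Inter>k\<le>n. - E k) \<and> (\<Inter>k\<le>n. - E k) \<in> sets M"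
    proof (induction n)
      case 0
      show ?case using resolvable_Compl[OF E(1)] Compl_sets[OF E(2)] by simp
    next
      case (Suc n)
      have "(\<Inter>k\<le>Suc n. - E k) = - E (Suc n) \<inter> (\<Inter>k\<le>n. - E k)" by (simp add: atMost_Suc)
      then show ?case
        using Suc resolvable_Int[OF resolvable_Compl[OF E(1)] Compl_sets[OF E(2)], of "\<Inter>k\<le>n. - E k" "Suc n"]
          sets.Int[OF Compl_sets[OF E(2)], of "\<Inter>k\<le>n. - E k" "Suc n"] by metis
    qed
    then show ?thesis
      unfolding F_def by (intro conjI resolvable_Compl Compl_sets) simp_all
  qed
  have Fsub: "F n \<subseteq> (\<Union>n. E n)" for n by (auto simp: F_def)
  have U: "(\<Union>n. E n) \<in> sets M" using E(2) by blast
  define D where "D n = R \<inter> ((\<Union>n. E n) - F n)" for n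
  have "(\<lambda>n. emeasure M (D n)) \<longlonglongrightarrow> emeasure M (\<Inter>n. D n)"
  proof (rule Lim_emeasure_decseq)
    show "range D \<subseteq> sets M" using F U pos_rectangles_sets[OF R] by (auto simp: D_def)
    show "decseq D" by (auto simp: D_def decseq_def F_def)
    have "emeasure M (D i) \<le> emeasure M R" for i
      by (intro emeasure_mono) (auto simp: D_def pos_rectangles_sets[OF R])
    then show "emeasure M (D i) \<noteq> \<infinity>" for i
      using rectangle_finite[of R] R by (metis infinity_ennreal_def leD pos_rectangles_def mem_Collect_eq)
  qed
  moreover have "(\<Inter>n. D n) = {}" by (auto simp: D_def F_def)
  ultimately have "(\<lambda>n. emeasure M (D n)) \<longlonglongrightarrow> 0" by simp
  then have "eventually (\<lambda>n. emeasure M (D n) < ennreal (e / 2)) sequentially"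
    using e by (intro order_tendstoD) auto
  then obtain n where n: "emeasure M (D n) < ennreal (e / 2)"
    by (meson eventually_sequentially order_refl)
  obtain t where t: "defect (F n) t R \<le> ennreal (e / 2)"
    using F R e unfolding resolvable_def by (meson half_gt_zero)
  have "defect (\<Union>n. E n) t R \<le> defect (F n) t R + emeasure M (D n)"
    unfolding D_def using F U Fsub R by (intro defect_subset) auto
  also have "\<dots> \<le> ennreal (e / 2) + ennreal (e / 2)"
    using n t by (intro add_mono) auto
  also have "\<dots> = ennreal e" using e by (simp flip: ennreal_plus)
  finally show "\<exists>t. defect (\<Union>n. E n) t R \<le> ennreal e" by blast
qed

text \<open>After a cut orthogonal to axis \<open>i\<close>, one half lies entirely inside or
  entirely outside the half-space and becomes a leaf without error. Only the other half stays
  undecided, and its mass is half the former.\<close>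

lemma resolvable_halfspace: "resolvable {x. x $ i \<le> q}"
  unfolding resolvable_def
proof (intro ballI allI impI)
  fix R and e :: real assume R: "R \<in> pos_rectangles M" and e: "e > 0"
  define H where "H = {x :: real ^ 'n. x $ i \<le> q}"
  have [measurable]: "H \<in> sets M" unfolding H_def by measurable
  \<comment> \<open>The bound \<open>r\<close> is kept separate from the measure of the cell, so
    that the induction can pass to a half together with \<open>r / 2\<close>.\<close>
  have ex: "\<exists>t. defect H t R \<le> ennreal (r / 2 ^ k)"
    if "R \<in> pos_rectangles M" "emeasure M R \<le> ennreal r" "r \<ge> 0" for k R r
    using that
  proof (induction k arbitrary: R r)
    case 0
    have "defect H Leaf R \<le> emeasure M R"
      using pos_rectangles_sets[OF 0(1)] by (auto intro!: min.coboundedI1 emeasure_mono)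
    also have "\<dots> \<le> ennreal (r / 2 ^ 0)" using 0 by simp
    finally show ?case by (rule exI)
  next
    case (Suc k)
    note low = lower_in[OF Suc.prems(1), of i] and up = upper_in[OF Suc.prems(1), of i]
    have half: "emeasure M R / 2 \<le> ennreal (r / 2)"
      using divide_right_mono_ennreal[OF Suc.prems(2), of 2] Suc.prems(3)
      by (simp add: ennreal_divide_numeral)
    show ?case
    proof (cases "q \<le> median i R")
      case True
      obtain t where t: "defect H t (lower i R) \<le> ennreal (r / 2 / 2 ^ k)"
        using Suc.IH[OF low, of "r / 2"] half emeasure_lower[OF Suc.prems(1)] Suc.prems(3) by auto
      have "upper i R \<inter> H = {}" using True by (auto simp: upper_def H_def)
      then have "defect H (Bisect i t Leaf) R \<le> ennreal (r / 2 ^ Suc k)"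
        using t by simp
      then show ?thesis by (rule exI)
    next
      case False
      obtain t where t: "defect H t (upper i R) \<le> ennreal (r / 2 / 2 ^ k)"
        using Suc.IH[OF up, of "r / 2"] half emeasure_upper[OF Suc.prems(1)] Suc.prems(3) by auto
      have "lower i R \<inter> - H = {}" using False by (auto simp: lower_def H_def)
      then have "defect H (Bisect i Leaf t) R \<le> ennreal (r / 2 ^ Suc k)"
        using t by simp
      then show ?thesis by (rule exI)
    qed
  qed
  have r: "emeasure M R = ennreal (measure M R)"
    using rectangle_finite[of R] R by (intro emeasure_eq_ennreal_measure) (auto simp: pos_rectangles_def)
  obtain k where k: "measure M R / e < 2 ^ k"
    using real_arch_pow[of 2 "measure M R / e"] by auto
  obtain t where "defect H t R \<le> ennreal (measure M R / 2 ^ k)"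
    using ex[OF R, of "measure M R" k] r by auto
  also have "\<dots> \<le> ennreal e"
    using k e by (intro ennreal_leI) (simp add: field_simps)
  finally show "\<exists>t. defect {x. x $ i \<le> q} t R \<le> ennreal e" unfolding H_def by blast
qed

theorem borel_resolvable:
  assumes "E \<in> sets M"
  shows "resolvable E"
proof -
  have "E \<in> sigma_sets UNIV ((\<lambda>(a, i). {x :: real ^ 'n. x \<bullet> i \<le> a}) ` (UNIV \<times> Basis))"
    using assms sets_M arg_cong[OF borel_eq_halfspace_le[where 'a = "real ^ 'n"], of sets] by simp
  \<comment> \<open>Measurability is carried through the induction because
    \<open>resolvable_UN\<close> asks for it.\<close>
  then have "resolvable E \<and> E \<in> sets M"
  proof (induction rule: sigma_sets.induct)
    case (Basic A)
    then obtain a and i :: 'n where "A = {x. x \<bullet> axis i 1 \<le> a}"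
      by (auto simp: Basis_vec_def)
    then have A: "A = {x. x $ i \<le> a}" by (simp add: inner_axis)
    show ?case unfolding A by (intro conjI resolvable_halfspace) measurable
  next
    case Empty
    show ?case unfolding resolvable_def by (auto intro: exI[of _ Leaf])
  next
    case (Compl A)
    then show ?case
      using resolvable_Compl[of A] Compl_sets[of A] by (simp add: Compl_eq_Diff_UNIV)
  next
    case (Union A)
    then show ?case using resolvable_UN[of A] by blast
  qed
  then show ?thesis by blast
qed

end

section \<open>The stopping argument\<close>

context null_frontier_radon
begin

lemma nn_integral_halves:
  assumes "R \<in> pos_rectangles M" and "g \<in> borel_measurable M"
  shows "(\<integral>\<^sup>+x\<in>R. g x \<partial>M) = (\<integral>\<^sup>+x\<in>lower i R. g x \<partial>M) + (\<integral>\<^sup>+x\<in>upper i R. g x \<partial>M)"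
  using nn_integral_disjoint_pair[of g M "lower i R" "upper i R"] assms lower_in[OF assms(1)] upper_in[OF assms(1)]
  by (simp add: lower_Un_upper lower_Int_upper pos_rectangles_sets)

text \<open>The tree is descended as long as the mean of \<open>h\<close> is at most 2. A cell where
  it exceeds 2 is settled by \<open>stop\<close>; these cells are disjoint, so their contributions
  add up to at most the last term. In a leaf that is reached, \<open>E\<close> is the minority part,
  so \<open>g\<close> is at most \<open>a\<close> off a set whose mass is counted by
  \<open>defect\<close>.\<close>

lemma stopping_estimate:
  fixes a b N :: ennreal
  assumes g [measurable]: "g \<in> borel_measurable M" and h [measurable]: "h \<in> borel_measurable M"
    and E [measurable]: "E \<in> sets M"
    and g_off: "\<And>x. x \<notin> E \<Longrightarrow> g x \<le> a" and g_le: "\<And>x. g x \<le> N"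
    and h_on: "\<And>x. x \<in> E \<Longrightarrow> 4 \<le> h x"
    and stop: "\<And>Z. Z \<in> pos_rectangles M \<Longrightarrow> 2 * emeasure M Z < (\<integral>\<^sup>+x\<in>Z. h x \<partial>M) \<Longrightarrow>
       (\<integral>\<^sup>+x\<in>Z. h x \<partial>M) \<le> 4 * emeasure M Z \<Longrightarrow> (\<integral>\<^sup>+x\<in>Z. g x \<partial>M) \<le> b * (\<integral>\<^sup>+x\<in>Z. h x \<partial>M)"
    and R: "R \<in> pos_rectangles M" and avg: "(\<integral>\<^sup>+x\<in>R. h x \<partial>M) \<le> 2 * emeasure M R"
  shows "(\<integral>\<^sup>+x\<in>R. g x \<partial>M) \<le> a * emeasure M R + N * defect E t R + b * (\<integral>\<^sup>+x\<in>R. h x \<partial>M)"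
  using R avg
proof (induction t arbitrary: R)
  case Leaf
  note [measurable] = pos_rectangles_sets[OF Leaf(1)]
  have cE: "- E \<in> sets M" using E by (rule Compl_sets)
  have "(\<integral>\<^sup>+x\<in>R. g x \<partial>M) \<le> (\<integral>\<^sup>+x. a * indicator R x + N * indicator (R \<inter> E) x \<partial>M)"
  proof (rule nn_integral_mono)
    fix x
    show "g x * indicator R x \<le> a * indicator R x + N * indicator (R \<inter> E) x"
      using g_off[of x] g_le[of x]
      by (cases "x \<in> E") (auto simp: indicator_def add_increasing)
  qed
  also have "\<dots> = a * emeasure M R + N * emeasure M (R \<inter> E)"
    by (subst nn_integral_add) (auto simp: nn_integral_cmult_indicator)
  \<comment> \<open>Markov's inequality: \<open>h\<close> is at least 4 on \<open>E\<close> and has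
    mean at most 2, so \<open>E\<close> fills at most half of the cell.\<close>
  also have "emeasure M (R \<inter> E) \<le> defect E Leaf R"
  proof -
    have split: "emeasure M R = emeasure M (R \<inter> E) + emeasure M (R \<inter> - E)"
      using plus_emeasure[of "R \<inter> E" M "R \<inter> - E"] pos_rectangles_sets[OF Leaf(1)] E cE
      by (simp add: Int_Un_distrib[symmetric] sets.Int)
    have "emeasure M R < \<infinity>" using Leaf(1) rectangle_finite by (simp add: pos_rectangles_def)
    then obtain u v where uv: "u \<ge> 0" "v \<ge> 0" "emeasure M (R \<inter> E) = ennreal u" "emeasure M (R \<inter> - E) = ennreal v"
      unfolding split by (cases "emeasure M (R \<inter> E)"; cases "emeasure M (R \<inter> - E)") auto
    have "4 * emeasure M (R \<inter> E) = (\<integral>\<^sup>+x. 4 * indicator (R \<inter> E) x \<partial>M)"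
      by (simp add: nn_integral_cmult_indicator)
    also have "\<dots> \<le> (\<integral>\<^sup>+x\<in>R. h x \<partial>M)"
      by (intro nn_integral_mono) (use h_on in \<open>auto simp: indicator_def\<close>)
    also have "\<dots> \<le> 2 * emeasure M R" by (rule Leaf(2))
    finally have "ennreal (4 * u) \<le> ennreal (2 * (u + v))"
      unfolding split uv using uv(1,2) by (simp add: ennreal_mult)
    then have "u \<le> v" using uv(1,2) by (simp del: ennreal_plus)
    then show ?thesis using uv by (simp add: ennreal_leI)
  qed
  finally show ?case by (simp add: mult_left_mono add_left_mono add_increasing2)
next
  case (Bisect i s t)
  \<comment> \<open>A half \<open>Z\<close> of \<open>R\<close> either inherits the mean bound 2,
    and the induction continues, or is stopped. In the latter case its mean is at most 4, twice that
    allowed for \<open>R\<close>, because \<open>Z\<close> carries half the mass of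
    \<open>R\<close>.\<close>
  have *: "(\<integral>\<^sup>+x\<in>Z. g x \<partial>M) \<le> a * emeasure M Z + N * defect E w Z + b * (\<integral>\<^sup>+x\<in>Z. h x \<partial>M)"
    if Z: "Z \<in> pos_rectangles M" "Z \<subseteq> R" "2 * emeasure M Z = emeasure M R"
      and IH: "(\<integral>\<^sup>+x\<in>Z. h x \<partial>M) \<le> 2 * emeasure M Z \<Longrightarrow>
        (\<integral>\<^sup>+x\<in>Z. g x \<partial>M) \<le> a * emeasure M Z + N * defect E w Z + b * (\<integral>\<^sup>+x\<in>Z. h x \<partial>M)" for Z w
  proof (cases "(\<integral>\<^sup>+x\<in>Z. h x \<partial>M) \<le> 2 * emeasure M Z")
    case False
    have "(\<integral>\<^sup>+x\<in>Z. h x \<partial>M) \<le> (\<integral>\<^sup>+x\<in>R. h x \<partial>M)"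
      using Z(2) by (intro nn_integral_mono) (auto simp: indicator_def)
    also have "\<dots> \<le> 2 * (2 * emeasure M Z)" using Bisect.prems(2) Z(3) by simp
    also have "\<dots> = 4 * emeasure M Z" by (simp flip: mult.assoc)
    finally have "(\<integral>\<^sup>+x\<in>Z. g x \<partial>M) \<le> b * (\<integral>\<^sup>+x\<in>Z. h x \<partial>M)"
      using stop[OF Z(1)] False by simp
    then show ?thesis by (rule order_trans) simp
  qed (rule IH)
  have "emeasure M R * 2 / 2 = emeasure M R" by (rule mult_divide_eq_ennreal) auto
  then have half: "2 * (emeasure M R / 2) = emeasure M R"
    by (simp add: ennreal_times_divide mult.commute)
  have l: "(\<integral>\<^sup>+x\<in>lower i R. g x \<partial>M) \<le> a * emeasure M (lower i R) + N * defect E s (lower i R)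
      + b * (\<integral>\<^sup>+x\<in>lower i R. h x \<partial>M)"
  proof (rule *)
    show "lower i R \<subseteq> R" by (auto simp: lower_def)
    show "2 * emeasure M (lower i R) = emeasure M R" unfolding emeasure_lower[OF Bisect.prems(1)] by (rule half)
  qed (use lower_in[OF Bisect.prems(1)] Bisect.IH(1) in blast)+
  have u: "(\<integral>\<^sup>+x\<in>upper i R. g x \<partial>M) \<le> a * emeasure M (upper i R) + N * defect E t (upper i R)
      + b * (\<integral>\<^sup>+x\<in>upper i R. h x \<partial>M)"
  proof (rule *)
    show "upper i R \<subseteq> R" by (auto simp: upper_def)
    show "2 * emeasure M (upper i R) = emeasure M R" unfolding emeasure_upper[OF Bisect.prems(1)] by (rule half)
  qed (use upper_in[OF Bisect.prems(1)] Bisect.IH(2) in blast)+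
  show ?case
    unfolding nn_integral_halves[OF Bisect.prems(1) g, of i] nn_integral_halves[OF Bisect.prems(1) h, of i]
      emeasure_halves[OF Bisect.prems(1), of i, symmetric]
    using add_mono[OF l u] by (simp add: distrib_left ac_simps)
qed

text \<open>Since \<open>N\<close> is finite, a tree resolving \<open>E\<close> finely enough makes
  the term \<open>N * defect E t R\<close> of \<open>stopping_estimate\<close> arbitrarily
  small.\<close>

lemma stopping_limit:
  fixes a b N :: ennreal
  assumes "g \<in> borel_measurable M" "h \<in> borel_measurable M" and E: "E \<in> sets M"
    and "\<And>x. x \<notin> E \<Longrightarrow> g x \<le> a" "\<And>x. g x \<le> N" and N: "N < \<infinity>"
    and "\<And>x. x \<in> E \<Longrightarrow> 4 \<le> h x"
    and "\<And>Z. Z \<in> pos_rectangles M \<Longrightarrow> 2 * emeasure M Z < (\<integral>\<^sup>+x\<in>Z. h x \<partial>M) \<Longrightarrow>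
       (\<integral>\<^sup>+x\<in>Z. h x \<partial>M) \<le> 4 * emeasure M Z \<Longrightarrow> (\<integral>\<^sup>+x\<in>Z. g x \<partial>M) \<le> b * (\<integral>\<^sup>+x\<in>Z. h x \<partial>M)"
    and R: "R \<in> pos_rectangles M" and "(\<integral>\<^sup>+x\<in>R. h x \<partial>M) \<le> 2 * emeasure M R"
  shows "(\<integral>\<^sup>+x\<in>R. g x \<partial>M) \<le> a * emeasure M R + b * (\<integral>\<^sup>+x\<in>R. h x \<partial>M)"
proof (rule ennreal_le_epsilon)
  fix e :: real assume e: "e > 0"
  obtain n where n: "n \<ge> 0" "N = ennreal n" using N by (cases N) auto
  \<comment> \<open>The denominator is \<open>n + 1\<close> because \<open>n\<close> may be
    0.\<close>
  obtain t where t: "defect E t R \<le> ennreal (e / (n + 1))"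
    using borel_resolvable[OF E] R e n(1) unfolding resolvable_def
    by (metis add_nonneg_pos divide_pos_pos zero_less_one)
  have "n * (e / (n + 1)) \<le> e" using e n(1) by (simp add: field_simps)
  then have "N * ennreal (e / (n + 1)) \<le> ennreal e"
    using n(1) e unfolding n(2) by (simp add: ennreal_leI flip: ennreal_mult)
  then have Ne: "N * defect E t R \<le> ennreal e"
    using mult_left_mono[OF t, of N] by (meson order_trans zero_le)
  have "(\<integral>\<^sup>+x\<in>R. g x \<partial>M) \<le> a * emeasure M R + N * defect E t R + b * (\<integral>\<^sup>+x\<in>R. h x \<partial>M)"
    by (rule stopping_estimate) (use assms in auto)
  also have "\<dots> \<le> a * emeasure M R + b * (\<integral>\<^sup>+x\<in>R. h x \<partial>M) + ennreal e"
    using Ne by (simp add: ac_simps add_left_mono)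
  finally show "(\<integral>\<^sup>+x\<in>R. g x \<partial>M) \<le> a * emeasure M R + b * (\<integral>\<^sup>+x\<in>R. h x \<partial>M) + ennreal e" .
qed

end

text \<open>The situation after dividing by a level of the Luxemburg norm: \<open>f\<close> is Borel
  and the level is 1, with one centre \<open>c R\<close> fixed for each rectangle. Concavity enters
  as subadditivity of \<open>\<phi>\<close>.\<close>

locale oscillation = null_frontier_radon M
  for M :: "(real ^ 'n) measure" +
  fixes \<phi> :: "real \<Rightarrow> real" and A :: real and f :: "real ^ 'n \<Rightarrow> real" and c :: "(real ^ 'n) set \<Rightarrow> real"
  assumes \<phi>_nonneg: "\<And>t. t \<ge> 0 \<Longrightarrow> 0 \<le> \<phi> t"
    and \<phi>_mono: "\<And>s t. 0 \<le> s \<Longrightarrow> s \<le> t \<Longrightarrow> \<phi> s \<le> \<phi> t"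
    and \<phi>_subadd: "\<And>s t. 0 \<le> s \<Longrightarrow> 0 \<le> t \<Longrightarrow> \<phi> (s + t) \<le> \<phi> s + \<phi> t"
    and \<phi>_meas [measurable]: "(\<lambda>t. \<phi> \<bar>t\<bar>) \<in> borel_measurable borel"
    and A: "A > 0" "\<And>t. t \<ge> A \<Longrightarrow> \<phi> t > 5"
    and f_meas [measurable]: "f \<in> borel_measurable M"
    and small: "\<And>R. R \<in> pos_rectangles M \<Longrightarrow> (\<integral>\<^sup>+x\<in>R. ennreal (\<phi> \<bar>f x - c R\<bar>) \<partial>M) \<le> emeasure M R"
begin

lemma \<phi>_comp_meas [measurable]: "(\<lambda>x. \<phi> \<bar>f x - d\<bar>) \<in> borel_measurable M"
  by (rule measurable_compose[OF _ \<phi>_meas]) measurable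

text \<open>Integrating \<open>\<phi> \<bar>c Z - d\<bar> \<le> \<phi> \<bar>f x - c Z\<bar> +
  \<phi> \<bar>f x - d\<bar>\<close> over \<open>Z\<close> bounds the constant on the left by 1 + 4,
  which is where the threshold 5 for \<open>A\<close> comes from.\<close>

lemma centres_close:
  assumes Z: "Z \<in> pos_rectangles M" and h: "(\<integral>\<^sup>+x\<in>Z. ennreal (\<phi> \<bar>f x - d\<bar>) \<partial>M) \<le> 4 * emeasure M Z"
  shows "\<bar>c Z - d\<bar> < A"
proof -
  note [measurable] = pos_rectangles_sets[OF Z]
  have "ennreal (\<phi> \<bar>c Z - d\<bar>) * emeasure M Z = (\<integral>\<^sup>+x. ennreal (\<phi> \<bar>c Z - d\<bar>) * indicator Z x \<partial>M)"
    by (simp add: nn_integral_cmult_indicator)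
  also have "\<dots> \<le> (\<integral>\<^sup>+x. ennreal (\<phi> \<bar>f x - c Z\<bar>) * indicator Z x + ennreal (\<phi> \<bar>f x - d\<bar>) * indicator Z x \<partial>M)"
  proof (rule nn_integral_mono)
    fix x
    have "\<phi> \<bar>c Z - d\<bar> \<le> \<phi> (\<bar>f x - c Z\<bar> + \<bar>f x - d\<bar>)" by (rule \<phi>_mono) auto
    also have "\<dots> \<le> \<phi> \<bar>f x - c Z\<bar> + \<phi> \<bar>f x - d\<bar>" by (rule \<phi>_subadd) auto
    finally have "ennreal (\<phi> \<bar>c Z - d\<bar>) \<le> ennreal (\<phi> \<bar>f x - c Z\<bar>) + ennreal (\<phi> \<bar>f x - d\<bar>)"
      by (simp add: \<phi>_nonneg ennreal_leI flip: ennreal_plus)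
    then show "ennreal (\<phi> \<bar>c Z - d\<bar>) * indicator Z x \<le>
        ennreal (\<phi> \<bar>f x - c Z\<bar>) * indicator Z x + ennreal (\<phi> \<bar>f x - d\<bar>) * indicator Z x"
      by (simp add: indicator_def)
  qed
  also have "\<dots> = (\<integral>\<^sup>+x\<in>Z. ennreal (\<phi> \<bar>f x - c Z\<bar>) \<partial>M) + (\<integral>\<^sup>+x\<in>Z. ennreal (\<phi> \<bar>f x - d\<bar>) \<partial>M)"
    by (intro nn_integral_add) measurable
  also have "\<dots> \<le> emeasure M Z + 4 * emeasure M Z"
    by (intro add_mono small Z h)
  also have "\<dots> = 5 * emeasure M Z"
    using distrib_right[of 1 4 "emeasure M Z"] by simp
  finally have le: "emeasure M Z * ennreal (\<phi> \<bar>c Z - d\<bar>) \<le> emeasure M Z * ennreal 5"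
    by (simp add: mult.commute)
  have "emeasure M Z < top" "0 < emeasure M Z"
    using Z rectangle_finite[of Z] by (auto simp: pos_rectangles_def)
  then have "ennreal (\<phi> \<bar>c Z - d\<bar>) \<le> ennreal 5"
    using le by (simp add: ennreal_mult_le_mult_iff)
  then have "\<phi> \<bar>c Z - d\<bar> \<le> 5" using ennreal_le_iff[of 5] by simp
  then show ?thesis using A(2)[of "\<bar>c Z - d\<bar>"] by linarith
qed

text \<open>A stopped cell \<open>Z\<close> has its centre within \<open>A\<close> of
  \<open>c R\<close>, so the truncated mean there is at most \<open>A + s\<close>. The mean of
  \<open>h\<close> on \<open>Z\<close> exceeds 2, hence the factor \<open>(A + s) / 2\<close>
  against the integral of \<open>h\<close>, which over \<open>R\<close> is at most the measure of
  \<open>R\<close>. The unstopped part contributes \<open>A\<close>.\<close>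

lemma truncated_step:
  assumes s: "s \<ge> 0" "N \<ge> 0"
    and bound: "\<And>R. R \<in> pos_rectangles M \<Longrightarrow> (\<integral>\<^sup>+x\<in>R. ennreal (min \<bar>f x - c R\<bar> N) \<partial>M) \<le> ennreal s * emeasure M R"
    and R: "R \<in> pos_rectangles M"
  shows "(\<integral>\<^sup>+x\<in>R. ennreal (min \<bar>f x - c R\<bar> N) \<partial>M) \<le> ennreal ((3 * A + s) / 2) * emeasure M R"
proof -
  let ?h = "\<lambda>x. ennreal (\<phi> \<bar>f x - c R\<bar>)" and ?g = "\<lambda>x. ennreal (min \<bar>f x - c R\<bar> N)"
  let ?b = "ennreal ((A + s) / 2)"
  define E where "E = {x. 4 < \<phi> \<bar>f x - c R\<bar>}"
  have "E = {x \<in> space M. 4 < \<phi> \<bar>f x - c R\<bar>}" by (simp add: E_def space_M)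
  also have "\<dots> \<in> sets M" by measurable
  finally have E: "E \<in> sets M" .
  have le1: "(\<integral>\<^sup>+x\<in>R. ?h x \<partial>M) \<le> 1 * emeasure M R" using small[OF R] by simp
  have "(\<integral>\<^sup>+x\<in>R. ?g x \<partial>M) \<le> ennreal A * emeasure M R + ?b * (\<integral>\<^sup>+x\<in>R. ?h x \<partial>M)"
  proof (rule stopping_limit[where E = E and N = "ennreal N"])
    fix x assume "x \<notin> E"
    then have "\<not> A \<le> \<bar>f x - c R\<bar>" using A(2)[of "\<bar>f x - c R\<bar>"] by (auto simp: E_def)
    then show "?g x \<le> ennreal A" by (intro ennreal_leI) auto
  next
    fix x assume "x \<in> E"
    then have "ennreal 4 \<le> ?h x" unfolding E_def by (intro ennreal_leI) simp
    then show "4 \<le> ?h x" by simp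
  next
    fix Z
    assume Z: "Z \<in> pos_rectangles M" and big: "2 * emeasure M Z < (\<integral>\<^sup>+x\<in>Z. ?h x \<partial>M)"
      and h4: "(\<integral>\<^sup>+x\<in>Z. ?h x \<partial>M) \<le> 4 * emeasure M Z"
    note [measurable] = pos_rectangles_sets[OF Z]
    have close: "\<bar>c Z - c R\<bar> < A" by (rule centres_close[OF Z h4])
    have "(\<integral>\<^sup>+x\<in>Z. ?g x \<partial>M) \<le>
        (\<integral>\<^sup>+x. ennreal A * indicator Z x + ennreal (min \<bar>f x - c Z\<bar> N) * indicator Z x \<partial>M)"
    proof (rule nn_integral_mono)
      fix x
      \<comment> \<open>Truncation at \<open>N\<close> does not increase differences, so changing
        the centre still costs at most \<open>A\<close>.\<close>
      have "min \<bar>f x - c R\<bar> N \<le> A + min \<bar>f x - c Z\<bar> N" using close by linarith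
      then have "?g x \<le> ennreal A + ennreal (min \<bar>f x - c Z\<bar> N)"
        using A(1) s(2) by (simp add: ennreal_leI flip: ennreal_plus)
      then show "?g x * indicator Z x \<le> ennreal A * indicator Z x + ennreal (min \<bar>f x - c Z\<bar> N) * indicator Z x"
        by (simp add: indicator_def)
    qed
    also have "\<dots> = ennreal A * emeasure M Z + (\<integral>\<^sup>+x\<in>Z. ennreal (min \<bar>f x - c Z\<bar> N) \<partial>M)"
      by (subst nn_integral_add) (auto simp: nn_integral_cmult_indicator)
    also have "\<dots> \<le> ennreal A * emeasure M Z + ennreal s * emeasure M Z"
      by (intro add_left_mono bound Z)
    also have "\<dots> = ennreal (A + s) * emeasure M Z"
      using A(1) s(1) by (simp add: distrib_right)
    also have "\<dots> = ?b * (2 * emeasure M Z)"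
    proof -
      have "ennreal (A + s) = ?b * ennreal 2"
        using A(1) s(1) by (subst ennreal_mult[symmetric]) (simp_all del: ennreal_plus)
      then show ?thesis by (simp add: mult.assoc)
    qed
    also have "\<dots> \<le> ?b * (\<integral>\<^sup>+x\<in>Z. ?h x \<partial>M)"
      using big by (intro mult_left_mono) auto
    finally show "(\<integral>\<^sup>+x\<in>Z. ?g x \<partial>M) \<le> ?b * (\<integral>\<^sup>+x\<in>Z. ?h x \<partial>M)" .
  next
    show "(\<integral>\<^sup>+x\<in>R. ?h x \<partial>M) \<le> 2 * emeasure M R"
      using le1 by (rule order_trans) (intro mult_right_mono, auto)
  qed (use E R in \<open>auto intro: ennreal_leI\<close>)
  also have "\<dots> \<le> ennreal A * emeasure M R + ?b * emeasure M R"
    using le1 by (intro add_left_mono mult_left_mono) auto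
  also have "\<dots> = ennreal (A + (A + s) / 2) * emeasure M R"
    using A(1) s(1) by (simp add: distrib_right)
  also have "A + (A + s) / 2 = (3 * A + s) / 2" by (simp add: field_simps)
  finally show ?thesis .
qed

text \<open>The map taking \<open>s\<close> to \<open>(3 * A + s) / 2\<close> has the fixed point
  \<open>3 * A\<close> and halves the distance to it. Iterating it from the trivial bound
  \<open>3 * A + N\<close>, uniformly in \<open>R\<close>, and letting \<open>k\<close> tend to
  infinity gives \<open>3 * A\<close> for each truncation; monotone convergence then removes
  \<open>N\<close>.\<close>

theorem mean_oscillation_le:
  assumes R: "R \<in> pos_rectangles M"
  shows "(\<integral>\<^sup>+x\<in>R. ennreal \<bar>f x - c R\<bar> \<partial>M) \<le> ennreal (3 * A) * emeasure M R"
proof -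
  note [measurable] = pos_rectangles_sets[OF R]
  have iter: "(\<integral>\<^sup>+x\<in>R. ennreal (min \<bar>f x - c R\<bar> N) \<partial>M) \<le> ennreal (3 * A + N / 2 ^ k) * emeasure M R"
    if R: "R \<in> pos_rectangles M" and N: "N \<ge> 0" for R N k
    using R
  proof (induction k arbitrary: R)
    case 0
    note [measurable] = pos_rectangles_sets[OF 0]
    have "(\<integral>\<^sup>+x\<in>R. ennreal (min \<bar>f x - c R\<bar> N) \<partial>M) \<le> (\<integral>\<^sup>+x. ennreal (3 * A + N) * indicator R x \<partial>M)"
      using A(1) by (intro nn_integral_mono mult_right_mono ennreal_leI) auto
    also have "\<dots> = ennreal (3 * A + N / 2 ^ 0) * emeasure M R" by (simp add: nn_integral_cmult_indicator)
    finally show ?case .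
  next
    case (Suc k)
    have "(\<integral>\<^sup>+x\<in>R. ennreal (min \<bar>f x - c R\<bar> N) \<partial>M) \<le>
        ennreal ((3 * A + (3 * A + N / 2 ^ k)) / 2) * emeasure M R"
      using A(1) N by (intro truncated_step Suc) auto
    also have "(3 * A + (3 * A + N / 2 ^ k)) / 2 = 3 * A + N / 2 ^ Suc k" by (simp add: field_simps)
    finally show ?case .
  qed
  obtain m where m: "m \<ge> 0" "emeasure M R = ennreal m"
    using rectangle_finite[of R] R by (cases "emeasure M R") (auto simp: pos_rectangles_def)
  have trunc: "(\<integral>\<^sup>+x\<in>R. ennreal (min \<bar>f x - c R\<bar> N) \<partial>M) \<le> ennreal (3 * A) * emeasure M R" if N: "N \<ge> 0" for N
  proof (rule LIMSEQ_le_const)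
    have "(\<lambda>k. N * (1 / 2) ^ k) \<longlonglongrightarrow> N * 0"
      by (intro tendsto_mult tendsto_const LIMSEQ_power_zero) simp
    then have "(\<lambda>k. N / 2 ^ k) \<longlonglongrightarrow> 0" by (simp add: power_divide)
    then have "(\<lambda>k. (3 * A + N / 2 ^ k) * m) \<longlonglongrightarrow> (3 * A + 0) * m"
      by (intro tendsto_intros)
    then have "(\<lambda>k. ennreal ((3 * A + N / 2 ^ k) * m)) \<longlonglongrightarrow> ennreal ((3 * A + 0) * m)"
      by (rule tendsto_ennrealI)
    then show "(\<lambda>k. ennreal (3 * A + N / 2 ^ k) * emeasure M R) \<longlonglongrightarrow> ennreal (3 * A) * emeasure M R"
      using A(1) m N by (simp add: ennreal_mult)
  qed (use iter[OF R N] in auto)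
  have sup: "(SUP n. ennreal (min y (real n))) = ennreal y" for y
  proof (rule antisym)
    obtain n where "y \<le> real n" using real_arch_simple by blast
    then have "ennreal y = ennreal (min y (real n))" by simp
    also have "\<dots> \<le> (SUP n. ennreal (min y (real n)))" by (rule SUP_upper) simp
    finally show "ennreal y \<le> (SUP n. ennreal (min y (real n)))" .
  qed (auto intro!: SUP_least ennreal_leI)
  have "(\<integral>\<^sup>+x\<in>R. ennreal \<bar>f x - c R\<bar> \<partial>M) =
      (\<integral>\<^sup>+x. (SUP n. ennreal (min \<bar>f x - c R\<bar> (real n)) * indicator R x) \<partial>M)"
    by (intro nn_integral_cong) (simp add: sup SUP_mult_right_ennreal[symmetric])
  also have "\<dots> = (SUP n. (\<integral>\<^sup>+x\<in>R. ennreal (min \<bar>f x - c R\<bar> (real n)) \<partial>M))"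
    by (intro nn_integral_monotone_convergence_SUP)
       (auto simp: incseq_def le_fun_def intro!: mult_right_mono ennreal_leI)
  also have "\<dots> \<le> ennreal (3 * A) * emeasure M R"
    by (intro SUP_least trunc) simp
  finally show ?thesis .
qed

end

section \<open>Concave gauges\<close>

locale concave_gauge =
  fixes \<phi> :: "real \<Rightarrow> real"
  assumes maps: "\<phi> \<in> {0..} \<rightarrow> {0..}"
    and mono: "mono_on {0..} \<phi>"
    and cont: "continuous_on {0..} \<phi>"
    and concave: "concave_on {0..} \<phi>"
    and zero: "\<phi> 0 = 0"
    and unbounded: "filterlim \<phi> at_top at_top"
begin

lemma gauge_nonneg: "t \<ge> 0 \<Longrightarrow> 0 \<le> \<phi> t"
  using maps by auto

lemma gauge_mono: "0 \<le> s \<Longrightarrow> s \<le> t \<Longrightarrow> \<phi> s \<le> \<phi> t"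
  using mono by (auto intro: mono_onD)

text \<open>Concavity together with \<open>\<phi> 0 = 0\<close> puts the graph above its chord from
  the origin, so each of \<open>s\<close> and \<open>t\<close> takes at least its proportional share
  of \<open>\<phi> (s + t)\<close>.\<close>

lemma gauge_subadd:
  assumes "0 \<le> s" "0 \<le> t"
  shows "\<phi> (s + t) \<le> \<phi> s + \<phi> t"
proof (cases "s + t = 0")
  case False
  then have pos: "s + t > 0" using assms by linarith
  have *: "u / (s + t) * \<phi> (s + t) \<le> \<phi> u" if "0 \<le> u" "u \<le> s + t" for u
    using concave_onD[OF concave, of "u / (s + t)" 0 "s + t"] that pos assms zero by simp
  have "\<phi> (s + t) = s / (s + t) * \<phi> (s + t) + t / (s + t) * \<phi> (s + t)"
    using pos by (simp add: add_divide_distrib[symmetric] distrib_right[symmetric])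
  also have "\<dots> \<le> \<phi> s + \<phi> t" using assms by (intro add_mono *) auto
  finally show ?thesis .
qed (use assms zero gauge_nonneg in auto)

lemma gauge_eventually_gt: "\<exists>A>0. \<forall>t\<ge>A. \<phi> t > K"
proof -
  have "eventually (\<lambda>t. \<phi> t > K) at_top" using unbounded by (simp add: filterlim_at_top_dense)
  then obtain B where "\<And>t. t \<ge> B \<Longrightarrow> \<phi> t > K" by (auto simp: eventually_at_top_linorder)
  then show ?thesis by (intro exI[of _ "max B 1"]) auto
qed

text \<open>Unboundedness provides a point \<open>u\<close> beyond \<open>t\<close> with a larger
  value; if \<open>\<phi>\<close> did not grow from \<open>s\<close> to \<open>t\<close>, its graph
  at \<open>t\<close> would lie below the chord from \<open>s\<close> to \<open>u\<close>.
  Injectivity, and with it the meaning of the inverse at 1, rests on this.\<close>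

lemma gauge_strict_mono:
  assumes "0 \<le> s" "s < t"
  shows "\<phi> s < \<phi> t"
proof (rule ccontr)
  assume no: "\<not> \<phi> s < \<phi> t"
  obtain A where A: "\<And>u. u \<ge> A \<Longrightarrow> \<phi> u > \<phi> t" using gauge_eventually_gt by blast
  define u where "u = max A (t + 1)"
  have u: "u > t" "\<phi> u > \<phi> t" using A[of u] by (auto simp: u_def)
  define w where "w = (t - s) / (u - s)"
  have w: "0 < w" "w < 1" using u(1) assms by (auto simp: w_def field_simps)
  have "(1 - w) * s + w * u = s + w * (u - s)" by (simp add: algebra_simps)
  also have "\<dots> = t" using u(1) assms by (simp add: w_def)
  finally have "(1 - w) * \<phi> s + w * \<phi> u \<le> \<phi> t"
    using concave_onD[OF concave, of w s u] w u(1) assms by simp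
  moreover have "(1 - w) * \<phi> t \<le> (1 - w) * \<phi> s" using no w by (intro mult_left_mono) auto
  moreover have "w * \<phi> t < w * \<phi> u" using u(2) w by (intro mult_strict_left_mono) auto
  ultimately show False by (simp add: algebra_simps)
qed

definition \<tau> :: real where "\<tau> = the_inv_into {0..} \<phi> 1"

lemma gauge_inv: "\<phi> \<tau> = 1" and gauge_inv_pos: "\<tau> > 0"
proof -
  have inj: "inj_on \<phi> {0..}"
    using gauge_strict_mono by (auto intro!: linorder_inj_onI' simp: less_le)
  obtain A where A: "A > 0" "\<And>t. t \<ge> A \<Longrightarrow> \<phi> t > 1" using gauge_eventually_gt by blast
  have "\<exists>t\<ge>0. t \<le> A \<and> \<phi> t = 1"
    using A zero by (intro IVT' continuous_on_subset[OF cont]) (auto intro: less_imp_le)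
  then have im: "1 \<in> \<phi> ` {0..}" by force
  show one: "\<phi> \<tau> = 1" unfolding \<tau>_def by (rule f_the_inv_into_f[OF inj im])
  have "\<tau> \<ge> 0" using the_inv_into_into[OF inj im, of "{0..}"] by (simp add: \<tau>_def)
  moreover have "\<tau> \<noteq> 0" using one zero by auto
  ultimately show "\<tau> > 0" by simp
qed

text \<open>This is the tangent inequality at \<open>\<tau>\<close> behind Jensen's inequality. It
  is arranged without subtraction, and with \<open>k\<close> nonnegative, so that it transfers to
  \<open>ennreal\<close>.\<close>

lemma supporting_line: "\<exists>k\<ge>0. \<forall>t\<ge>0. \<phi> t + k * \<tau> \<le> 1 + k * t"
proof -
  \<comment> \<open>The infimum is the right derivative at \<open>\<tau>\<close> of the convex
    function \<open>- \<phi>\<close>, so \<open>k\<close> is the right derivative of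
    \<open>\<phi>\<close> there.\<close>
  define k where "k = - Inf ((\<lambda>t. (- \<phi> \<tau> - - \<phi> t) / (\<tau> - t)) ` ({\<tau><..} \<inter> {0..}))"
  have "convex_on {0..} (\<lambda>t. - \<phi> t)" using concave by (simp add: concave_on_def)
  moreover have "\<tau> \<in> interior {0..}" using gauge_inv_pos by (simp add: interior_real_atLeast)
  ultimately have line: "\<phi> t + k * \<tau> \<le> 1 + k * t" if "t \<ge> 0" for t
    using convex_le_Inf_differential[of "{0..}" "\<lambda>t. - \<phi> t" \<tau> t] that gauge_inv
    unfolding k_def by (simp add: algebra_simps)
  have "1 < \<phi> (\<tau> + 1)" using gauge_strict_mono[of \<tau> "\<tau> + 1"] gauge_inv gauge_inv_pos by simp
  then have "k \<ge> 0" using line[of "\<tau> + 1"] gauge_inv_pos by (simp add: algebra_simps)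
  then show ?thesis using line by blast
qed

lemma gauge_measurable [measurable]: "(\<lambda>t. \<phi> \<bar>t\<bar>) \<in> borel_measurable borel"
  by (intro borel_measurable_continuous_onI continuous_on_compose2[OF cont]) (auto intro!: continuous_intros)

lemma gauge_comp_measurable:
  assumes "g \<in> borel_measurable N" "l > 0"
  shows "(\<lambda>x. \<phi> (\<bar>g x\<bar> / l)) \<in> borel_measurable N"
proof -
  have "(\<lambda>x. \<phi> \<bar>g x / l\<bar>) \<in> borel_measurable N"
    by (rule measurable_compose[OF _ gauge_measurable]) (use assms in measurable)
  then show ?thesis using assms(2) by (simp add: abs_divide)
qed

end

section \<open>Comparison of the two norms\<close>

context null_frontier_radon
begin

lemma pos_rectangle_measure:
  assumes "R \<in> pos_rectangles M"
  shows "emeasure M R = ennreal (measure M R)" "measure M R > 0"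
proof -
  have "emeasure M R \<noteq> \<infinity>" "emeasure M R > 0"
    using assms rectangle_finite[of R] by (auto simp: pos_rectangles_def)
  then show eq: "emeasure M R = ennreal (measure M R)"
    by (intro emeasure_eq_ennreal_measure) auto
  show "measure M R > 0" using \<open>emeasure M R > 0\<close> unfolding eq by simp
qed

lemma divide_le_iff_pos_rectangle:
  assumes "R \<in> pos_rectangles M" "b \<ge> 0"
  shows "y / emeasure M R \<le> ennreal b \<longleftrightarrow> y \<le> ennreal b * emeasure M R"
  unfolding pos_rectangle_measure(1)[OF assms(1)]
  using pos_rectangle_measure(2)[OF assms(1)] assms(2)
  by (cases y)
     (simp_all add: divide_ennreal pos_divide_le_eq top_unique ennreal_mult_eq_top_iff
       ennreal_top_divide flip: ennreal_mult)

lemma rectangle_sets_completion: "rectangle R \<Longrightarrow> R \<in> sets (completion M)"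
  using rectangle_sets by (rule sets_completionI_sets)

text \<open>The average differs from \<open>c\<close> by at most the mean of
  \<open>\<bar>f x - c\<bar>\<close>, hence by at most \<open>B\<close>; the triangle inequality
  gives the factor 2.\<close>

lemma oscillation_about_avg:
  assumes f [measurable]: "f \<in> borel_measurable (completion M)" and R: "R \<in> pos_rectangles M" and B: "B \<ge> 0"
    and le: "(\<integral>\<^sup>+x\<in>R. ennreal \<bar>f x - c\<bar> \<partial>completion M) \<le> ennreal B * emeasure M R"
  shows "set_integrable (completion M) R f"
    and "(\<integral>\<^sup>+x\<in>R. ennreal \<bar>f x - avg M R f\<bar> \<partial>completion M) \<le> ennreal (2 * B) * emeasure M R"
proof -
  note m = pos_rectangle_measure[OF R]
  have RM [measurable]: "R \<in> sets (completion M)" and RM': "R \<in> sets M"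
    using R rectangle_sets_completion rectangle_sets by (auto simp: pos_rectangles_def)
  have mR: "emeasure (completion M) R = ennreal (measure M R)" "measure (completion M) R = measure M R"
    using RM' m(1) by (simp_all add: measure_completion)
  have norm_eq: "(\<integral>\<^sup>+x. ennreal (norm (indicator R x *\<^sub>R (f x - c))) \<partial>completion M) =
      (\<integral>\<^sup>+x\<in>R. ennreal \<bar>f x - c\<bar> \<partial>completion M)"
    by (intro nn_integral_cong) (simp add: indicator_def)
  have le': "(\<integral>\<^sup>+x\<in>R. ennreal \<bar>f x - c\<bar> \<partial>completion M) \<le> ennreal (B * measure M R)"
    using le B m by (simp add: ennreal_mult)
  have fc: "set_integrable (completion M) R (\<lambda>x. f x - c)"
    unfolding set_integrable_def
    by (rule integrableI_bounded) (measurable, use norm_eq le' in \<open>simp add: order_le_less_trans\<close>)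
  have cc: "set_integrable (completion M) R (\<lambda>x. c)"
    unfolding set_integrable_def using mR by (intro integrable_scaleR_left integrable_real_indicator) auto
  show fi: "set_integrable (completion M) R f"
    using set_integral_add(1)[OF fc cc] by simp
  have "avg M R f = c + (1 / measure M R) * (LINT x:R|completion M. f x - c)"
  proof -
    have "(LINT x:R|completion M. f x) = (LINT x:R|completion M. f x - c) + (LINT x:R|completion M. c)"
      using set_integral_add(2)[OF fc cc] by simp
    also have "(LINT x:R|completion M. c) = c * measure M R"
      using mR by (simp add: set_lebesgue_integral_def space_M)
    finally show ?thesis using m(2) by (simp add: avg_def field_simps)
  qed
  moreover have "\<bar>LINT x:R|completion M. f x - c\<bar> \<le> B * measure M R"
  proof -
    have "ennreal \<bar>LINT x:R|completion M. f x - c\<bar> \<le> ennreal (B * measure M R)"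
      using integral_norm_bound_ennreal[OF fc[unfolded set_integrable_def]] norm_eq le'
      unfolding set_lebesgue_integral_def by simp
    then show ?thesis using B by (simp add: ennreal_le_iff)
  qed
  ultimately have close: "\<bar>avg M R f - c\<bar> \<le> B"
    using m(2) by (simp add: abs_mult divide_le_eq)
  have "(\<integral>\<^sup>+x\<in>R. ennreal \<bar>f x - avg M R f\<bar> \<partial>completion M) \<le>
      (\<integral>\<^sup>+x. ennreal \<bar>f x - c\<bar> * indicator R x + ennreal B * indicator R x \<partial>completion M)"
  proof (rule nn_integral_mono)
    fix x
    have "\<bar>f x - avg M R f\<bar> \<le> \<bar>f x - c\<bar> + B" using close by linarith
    then have "ennreal \<bar>f x - avg M R f\<bar> \<le> ennreal \<bar>f x - c\<bar> + ennreal B"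
      using B by (simp add: ennreal_leI flip: ennreal_plus)
    then show "ennreal \<bar>f x - avg M R f\<bar> * indicator R x \<le>
        ennreal \<bar>f x - c\<bar> * indicator R x + ennreal B * indicator R x"
      by (simp add: indicator_def)
  qed
  also have "\<dots> = (\<integral>\<^sup>+x\<in>R. ennreal \<bar>f x - c\<bar> \<partial>completion M) + ennreal B * emeasure M R"
    using mR m(1) by (subst nn_integral_add) (auto simp: nn_integral_cmult_indicator)
  also have "\<dots> \<le> ennreal B * emeasure M R + ennreal B * emeasure M R"
    by (intro add_right_mono le)
  also have "\<dots> = (ennreal B + ennreal B) * emeasure M R" by (simp add: distrib_right)
  also have "ennreal B + ennreal B = ennreal (2 * B)" using B by (simp flip: ennreal_plus)
  finally show "(\<integral>\<^sup>+x\<in>R. ennreal \<bar>f x - avg M R f\<bar> \<partial>completion M) \<le> ennreal (2 * B) * emeasure M R" .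
qed

text \<open>The finite case of \<open>bmo_norm\<close> asks for integrability on every rectangle,
  including the null ones, to which the mean oscillation bounds do not speak.\<close>

lemma null_rectangle_integrable:
  assumes f [measurable]: "f \<in> borel_measurable (completion M)" and R: "rectangle R" "emeasure M R = 0"
  shows "set_integrable (completion M) R (f :: real ^ 'n \<Rightarrow> real)"
proof -
  have [measurable]: "R \<in> sets (completion M)" using R(1) by (rule rectangle_sets_completion)
  have "R \<in> null_sets M" using R rectangle_sets by (auto simp: null_sets_def)
  then have "AE x in completion M. x \<notin> R" by (intro AE_completion AE_not_in)
  then have "AE x in completion M. indicator R x *\<^sub>R f x = 0"
    by (rule AE_mp) (auto intro!: AE_I2)
  then show ?thesis
    unfolding set_integrable_def by (subst integrable_cong_AE[where g = "\<lambda>x. 0"]) auto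
qed

end

section \<open>The two inequalities between the norms\<close>

locale gauged_measure = null_frontier_radon M + concave_gauge \<phi>
  for M :: "(real ^ 'n) measure" and \<phi> :: "real \<Rightarrow> real"
begin

text \<open>Jensen's inequality: the supporting line is evaluated at
  \<open>\<bar>f x - a\<bar> / l\<close> and integrated over \<open>R\<close>. The term
  \<open>k * \<tau>\<close> times the measure of \<open>R\<close> stands on both sides throughout
  and is cancelled at the end, being finite.\<close>

lemma lux_norm_avg_le:
  assumes f [measurable]: "f \<in> borel_measurable (completion M)" and R: "R \<in> pos_rectangles M"
    and le: "(\<integral>\<^sup>+x\<in>R. ennreal \<bar>f x - a\<bar> \<partial>completion M) \<le> ennreal b * emeasure M R"
    and b: "0 \<le> b" and l: "0 < l" "b \<le> l * \<tau>"
  shows "lux_norm \<phi> R M (\<lambda>x. f x - a) \<le> ennreal l"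
proof -
  note m = pos_rectangle_measure[OF R]
  have RM [measurable]: "R \<in> sets (completion M)" and RM': "R \<in> sets M"
    using R rectangle_sets_completion rectangle_sets by (auto simp: pos_rectangles_def)
  obtain k where k: "k \<ge> 0" "\<And>t. t \<ge> 0 \<Longrightarrow> \<phi> t + k * \<tau> \<le> 1 + k * t"
    using supporting_line by blast
  have [measurable]: "(\<lambda>x. \<phi> (\<bar>f x - a\<bar> / l)) \<in> borel_measurable (completion M)"
    by (rule gauge_comp_measurable) (use l in measurable)
  have "(\<integral>\<^sup>+x\<in>R. ennreal (\<phi> (\<bar>f x - a\<bar> / l)) \<partial>completion M) + ennreal (k * \<tau>) * emeasure M R =
      (\<integral>\<^sup>+x. ennreal (\<phi> (\<bar>f x - a\<bar> / l)) * indicator R x + ennreal (k * \<tau>) * indicator R x \<partial>completion M)"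
    using RM' by (subst nn_integral_add) (auto simp: nn_integral_cmult_indicator)
  also have "\<dots> \<le> (\<integral>\<^sup>+x. indicator R x + ennreal (k / l) * (ennreal \<bar>f x - a\<bar> * indicator R x) \<partial>completion M)"
  proof (rule nn_integral_mono)
    fix x
    have "\<phi> (\<bar>f x - a\<bar> / l) + k * \<tau> \<le> 1 + k / l * \<bar>f x - a\<bar>"
      using k(2)[of "\<bar>f x - a\<bar> / l"] l by simp
    then have "ennreal (\<phi> (\<bar>f x - a\<bar> / l) + k * \<tau>) \<le> ennreal (1 + k / l * \<bar>f x - a\<bar>)"
      by (rule ennreal_leI)
    also have "\<dots> = 1 + ennreal (k / l) * ennreal \<bar>f x - a\<bar>"
      using k(1) l by (simp add: ennreal_mult del: times_divide_eq_left)
    also have "ennreal (\<phi> (\<bar>f x - a\<bar> / l) + k * \<tau>) = ennreal (\<phi> (\<bar>f x - a\<bar> / l)) + ennreal (k * \<tau>)"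
      using k(1) l gauge_nonneg gauge_inv_pos by (intro ennreal_plus) auto
    finally show "ennreal (\<phi> (\<bar>f x - a\<bar> / l)) * indicator R x + ennreal (k * \<tau>) * indicator R x \<le>
        indicator R x + ennreal (k / l) * (ennreal \<bar>f x - a\<bar> * indicator R x)"
      by (simp add: indicator_def)
  qed
  also have "\<dots> = emeasure M R + ennreal (k / l) * (\<integral>\<^sup>+x\<in>R. ennreal \<bar>f x - a\<bar> \<partial>completion M)"
    using RM' by (subst nn_integral_add) (auto simp: nn_integral_cmult)
  also have "\<dots> \<le> emeasure M R + ennreal (k / l) * (ennreal b * emeasure M R)"
    using le by (intro add_left_mono mult_left_mono) auto
  also have "\<dots> = emeasure M R + ennreal (k / l * b) * emeasure M R"
    using k(1) l b by (simp add: ennreal_mult mult.assoc del: times_divide_eq_left)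
  also have "\<dots> \<le> emeasure M R + ennreal (k * \<tau>) * emeasure M R"
  proof -
    have "k / l * b \<le> k / l * (l * \<tau>)" using k(1) l by (intro mult_left_mono) auto
    also have "\<dots> = k * \<tau>" using l by simp
    finally show ?thesis by (intro add_left_mono mult_right_mono ennreal_leI) auto
  qed
  finally have "(\<integral>\<^sup>+x\<in>R. ennreal (\<phi> (\<bar>f x - a\<bar> / l)) \<partial>completion M) \<le> ennreal 1 * emeasure M R"
    using m by (simp add: ennreal_mult_eq_top_iff ennreal_add_left_cancel_le add.commute[of _ "ennreal (k * \<tau>) * _"])
  then have "(\<integral>\<^sup>+x\<in>R. ennreal (\<phi> (\<bar>f x - a\<bar> / l)) \<partial>completion M) / emeasure M R \<le> 1"
    using divide_le_iff_pos_rectangle[OF R, of 1] by simp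
  then show ?thesis unfolding lux_norm_def using l by (intro Inf_lower) auto
qed

lemma bmo_phi_norm_le:
  assumes f: "f \<in> borel_measurable (completion M)"
  shows "ennreal \<tau> * bmo_phi_norm \<phi> M f \<le> bmo_norm M f"
proof (cases "bmo_norm M f")
  case (real b)
  have bound: "(\<integral>\<^sup>+x\<in>R. ennreal \<bar>f x - avg M R f\<bar> \<partial>completion M) \<le> ennreal b * emeasure M R"
    if R: "R \<in> pos_rectangles M" for R
  proof -
    have "bmo_norm M f = (SUP R\<in>pos_rectangles M.
        (\<integral>\<^sup>+x\<in>R. ennreal \<bar>f x - avg M R f\<bar> \<partial>completion M) / emeasure M R)"
      using real by (auto simp: bmo_norm_def split: if_splits)
    then have "(\<integral>\<^sup>+x\<in>R. ennreal \<bar>f x - avg M R f\<bar> \<partial>completion M) / emeasure M R \<le> ennreal b"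
      using real R by (metis (no_types, lifting) SUP_upper)
    then show ?thesis using divide_le_iff_pos_rectangle[OF R] real by simp
  qed
  show ?thesis
  proof (rule ennreal_le_epsilon)
    fix e :: real assume e: "e > 0"
    \<comment> \<open>The summand \<open>e\<close> keeps the level positive even when
      \<open>b\<close> is 0. The average of \<open>f\<close> serves as competitor in the infimum
      over \<open>c\<close>.\<close>
    define l where "l = (b + e) / \<tau>"
    have l: "l > 0" "b \<le> l * \<tau>" "\<tau> * l = b + e" using e real gauge_inv_pos by (auto simp: l_def add_nonneg_pos)
    have "bmo_phi_norm \<phi> M f \<le> ennreal l"
      unfolding bmo_phi_norm_def
    proof (rule SUP_least)
      fix R assume R: "R \<in> pos_rectangles M"
      have "lux_norm \<phi> R M (\<lambda>x. f x - avg M R f) \<le> ennreal l"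
        using lux_norm_avg_le[OF f R bound[OF R]] real l by simp
      then show "(INF c. lux_norm \<phi> R M (\<lambda>x. f x - c)) \<le> ennreal l"
        by (rule INF_lower2[OF UNIV_I])
    qed
    then have "ennreal \<tau> * bmo_phi_norm \<phi> M f \<le> ennreal \<tau> * ennreal l" by (rule mult_left_mono) simp
    also have "\<dots> = ennreal (b + e)" using l gauge_inv_pos by (simp flip: ennreal_mult)
    also have "\<dots> = bmo_norm M f + ennreal e" using real e by simp
    finally show "ennreal \<tau> * bmo_phi_norm \<phi> M f \<le> bmo_norm M f + ennreal e" .
  qed
qed simp

text \<open>Admissible levels are closed upwards because \<open>\<phi>\<close> is increasing. With
  the strict inequality some admissible level lies below \<open>l\<close>, whether or not the
  infimum is attained.\<close>

lemma lux_norm_lessD: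
  assumes "R \<in> pos_rectangles M" "0 < l" "lux_norm \<phi> R M g < ennreal l"
  shows "(\<integral>\<^sup>+x\<in>R. ennreal (\<phi> (\<bar>g x\<bar> / l)) \<partial>completion M) \<le> emeasure M R"
proof -
  obtain k where k: "0 < k" "ennreal k < ennreal l"
    "(\<integral>\<^sup>+x\<in>R. ennreal (\<phi> (\<bar>g x\<bar> / k)) \<partial>completion M) / emeasure M R \<le> 1"
    using assms(3) unfolding lux_norm_def Inf_less_iff by auto
  then have "k \<le> l" using assms(2) by (simp add: ennreal_less_iff)
  then have "(\<integral>\<^sup>+x\<in>R. ennreal (\<phi> (\<bar>g x\<bar> / l)) \<partial>completion M) \<le> (\<integral>\<^sup>+x\<in>R. ennreal (\<phi> (\<bar>g x\<bar> / k)) \<partial>completion M)"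
    using k(1) by (intro nn_integral_mono mult_right_mono ennreal_leI gauge_mono) (auto intro: divide_left_mono)
  also have "\<dots> \<le> emeasure M R"
    using k(3) divide_le_iff_pos_rectangle[OF assms(1), of 1] by simp
  finally show ?thesis .
qed

text \<open>For each level \<open>l\<close> above the norm, near-optimal centres exist and
  \<open>mean_oscillation_le\<close> applies to \<open>f\<close> divided by \<open>l\<close>, giving
  \<open>3 * A * l\<close>. Replacing centres by averages doubles this to \<open>6 * A * l\<close>,
  and \<open>l\<close> then decreases to the norm.\<close>

lemma bmo_norm_le:
  assumes f: "f \<in> borel_measurable (completion M)"
    and A: "A > 0" "\<And>t. t \<ge> A \<Longrightarrow> \<phi> t > 5"
  shows "bmo_norm M f \<le> ennreal (6 * A) * bmo_phi_norm \<phi> M f"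
proof (cases "bmo_phi_norm \<phi> M f")
  case (real p)
  \<comment> \<open>The stopping argument works with Borel functions and \<open>M\<close> itself, so
    \<open>f\<close> is replaced by a Borel function equal to it almost everywhere.\<close>
  obtain g where g [measurable]: "g \<in> borel_measurable M" and fg: "AE x in M. f x = g x"
    using completion_ex_borel_measurable_real[OF f] by blast
  have main: "bmo_norm M f \<le> ennreal (6 * A * l)" if l: "p < l" for l
  proof -
    have lpos: "l > 0" using l real by simp
    have "\<exists>c. (\<integral>\<^sup>+x\<in>R. ennreal (\<phi> \<bar>g x / l - c / l\<bar>) \<partial>M) \<le> emeasure M R"
      if R: "R \<in> pos_rectangles M" for R
    proof -
      have "(INF c. lux_norm \<phi> R M (\<lambda>x. f x - c)) \<le> bmo_phi_norm \<phi> M f"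
        unfolding bmo_phi_norm_def using R by (rule SUP_upper)
      also have "\<dots> < ennreal l" using real l by (simp add: ennreal_less_iff)
      finally obtain c where "lux_norm \<phi> R M (\<lambda>x. f x - c) < ennreal l"
        unfolding Inf_less_iff by blast
      then have "(\<integral>\<^sup>+x\<in>R. ennreal (\<phi> (\<bar>f x - c\<bar> / l)) \<partial>completion M) \<le> emeasure M R"
        by (rule lux_norm_lessD[OF R lpos])
      moreover have "(\<integral>\<^sup>+x\<in>R. ennreal (\<phi> (\<bar>f x - c\<bar> / l)) \<partial>completion M) =
          (\<integral>\<^sup>+x\<in>R. ennreal (\<phi> \<bar>g x / l - c / l\<bar>) \<partial>M)"
        unfolding nn_integral_completion
      proof (rule nn_integral_cong_AE, use fg in eventually_elim)
        fix x assume "f x = g x"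
        then show "ennreal (\<phi> (\<bar>f x - c\<bar> / l)) * indicator R x = ennreal (\<phi> \<bar>g x / l - c / l\<bar>) * indicator R x"
          using lpos by (simp add: abs_divide flip: diff_divide_distrib)
      qed
      ultimately show ?thesis by (intro exI[of _ c]) simp
    qed
    then obtain c where c: "\<And>R. R \<in> pos_rectangles M \<Longrightarrow>
        (\<integral>\<^sup>+x\<in>R. ennreal (\<phi> \<bar>g x / l - c R / l\<bar>) \<partial>M) \<le> emeasure M R"
      by metis
    interpret oscillation M \<phi> A "\<lambda>x. g x / l" "\<lambda>R. c R / l"
      by unfold_locales (use A c gauge_nonneg gauge_mono gauge_subadd in auto)
    have osc: "(\<integral>\<^sup>+x\<in>R. ennreal \<bar>f x - c R\<bar> \<partial>completion M) \<le> ennreal (3 * A * l) * emeasure M R"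
      if R: "R \<in> pos_rectangles M" for R
    proof -
      note [measurable] = pos_rectangles_sets[OF R]
      have "(\<integral>\<^sup>+x\<in>R. ennreal \<bar>f x - c R\<bar> \<partial>completion M) =
          (\<integral>\<^sup>+x. ennreal l * (ennreal \<bar>g x / l - c R / l\<bar> * indicator R x) \<partial>M)"
        unfolding nn_integral_completion
      proof (rule nn_integral_cong_AE, use fg in eventually_elim)
        fix x assume "f x = g x"
        then have "\<bar>f x - c R\<bar> = l * \<bar>g x / l - c R / l\<bar>"
          using lpos by (simp add: abs_divide flip: diff_divide_distrib)
        then show "ennreal \<bar>f x - c R\<bar> * indicator R x = ennreal l * (ennreal \<bar>g x / l - c R / l\<bar> * indicator R x)"
          using lpos by (simp add: ennreal_mult mult.assoc)
      qed
      also have "\<dots> = ennreal l * (\<integral>\<^sup>+x\<in>R. ennreal \<bar>g x / l - c R / l\<bar> \<partial>M)"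
        by (rule nn_integral_cmult) measurable
      also have "\<dots> \<le> ennreal l * (ennreal (3 * A) * emeasure M R)"
        by (intro mult_left_mono mean_oscillation_le R) simp
      also have "\<dots> = ennreal (3 * A * l) * emeasure M R"
        using A(1) lpos by (simp add: ennreal_mult ac_simps)
      finally show ?thesis .
    qed
    have pos: "0 \<le> 3 * A * l" using A(1) lpos by simp
    note about = oscillation_about_avg[OF f _ pos osc]
    have "set_integrable (completion M) R f" if "rectangle R" for R
    proof (cases "emeasure M R = 0")
      case False
      then have "R \<in> pos_rectangles M" using that by (simp add: pos_rectangles_def zero_less_iff_neq_zero)
      then show ?thesis by (intro about(1))
    qed (use null_rectangle_integrable[OF f that] in blast)
    moreover have "(\<integral>\<^sup>+x\<in>R. ennreal \<bar>f x - avg M R f\<bar> \<partial>completion M) / emeasure M R \<le> ennreal (6 * A * l)"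
      if R: "R \<in> pos_rectangles M" for R
      using about(2)[OF R R] divide_le_iff_pos_rectangle[OF R, of "6 * A * l"] A(1) lpos by (simp add: mult.assoc)
    ultimately show ?thesis unfolding bmo_norm_def by (auto intro: SUP_least)
  qed
  show ?thesis
  proof (rule ennreal_le_epsilon)
    fix e :: real assume e: "e > 0"
    have "bmo_norm M f \<le> ennreal (6 * A * (p + e / (6 * A)))"
      using e A(1) by (intro main) simp
    also have "6 * A * (p + e / (6 * A)) = 6 * A * p + e" using A(1) by (simp add: field_simps)
    also have "ennreal (6 * A * p + e) = ennreal (6 * A) * bmo_phi_norm \<phi> M f + ennreal e"
      using e A(1) real by (simp add: ennreal_mult)
    finally show "bmo_norm M f \<le> ennreal (6 * A) * bmo_phi_norm \<phi> M f + ennreal e" .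
  qed
next
  case top
  then show ?thesis using A(1) by (simp add: ennreal_mult_top)
qed

end

theorem theorem1p7:
  fixes \<phi> :: "real \<Rightarrow> real"
  assumes "\<phi> \<in> {0..} \<rightarrow> {0..}"
    and "mono_on {0..} \<phi>"
    and "continuous_on {0..} \<phi>"
    and "concave_on {0..} \<phi>"
    and "\<phi> 0 = 0"
    and "filterlim \<phi> at_top at_top"
  shows "\<exists>C :: real. \<forall>M :: (real ^ 'n) measure.
    radon_measure M \<and> (\<forall>x. emeasure M {x} = 0) \<and>
    (\<forall>R. rectangle R \<longrightarrow> emeasure M (frontier R) = 0) \<longrightarrow>
      bmo M = bmo_phi \<phi> M \<and>
      (\<forall>f \<in> borel_measurable (completion M).
         ennreal (the_inv_into {0..} \<phi> 1) * bmo_phi_norm \<phi> M f \<le> bmo_norm M f \<and>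
         bmo_norm M f \<le> ennreal C * bmo_phi_norm \<phi> M f)"
proof -
  interpret gauge: concave_gauge \<phi> by (rule concave_gauge.intro) (rule assms)+
  obtain A where A: "A > 0" "\<And>t. t \<ge> A \<Longrightarrow> \<phi> t > 5" using gauge.gauge_eventually_gt by blast
  show ?thesis
  \<comment> \<open>\<open>A\<close> was obtained from \<open>\<phi>\<close> alone before
    \<open>M\<close> is introduced, so the constant is uniform in the measure and in
    \<open>f\<close>.\<close>
  proof (intro exI[of _ "6 * A"] allI impI, elim conjE)
    fix M :: "(real ^ 'n) measure"
    assume "radon_measure M" and "\<forall>R. rectangle R \<longrightarrow> emeasure M (frontier R) = 0"
    then interpret gauged_measure M \<phi> by unfold_locales auto
    have low: "ennreal (the_inv_into {0..} \<phi> 1) * bmo_phi_norm \<phi> M f \<le> bmo_norm M f"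
      and up: "bmo_norm M f \<le> ennreal (6 * A) * bmo_phi_norm \<phi> M f"
      if "f \<in> borel_measurable (completion M)" for f
      using bmo_phi_norm_le[OF that] bmo_norm_le[OF that A] by (simp_all add: gauge.\<tau>_def)
    have "bmo_norm M f < \<infinity> \<longleftrightarrow> bmo_phi_norm \<phi> M f < \<infinity>" if f: "f \<in> borel_measurable (completion M)" for f
    proof
      assume "bmo_norm M f < \<infinity>"
      then have "ennreal gauge.\<tau> * bmo_phi_norm \<phi> M f < \<infinity>" using bmo_phi_norm_le[OF f] by (rule le_less_trans[rotated])
      then show "bmo_phi_norm \<phi> M f < \<infinity>"
        using gauge.gauge_inv_pos by (auto simp: ennreal_mult_less_top)
    next
      assume "bmo_phi_norm \<phi> M f < \<infinity>"
      then have "ennreal (6 * A) * bmo_phi_norm \<phi> M f < \<infinity>" by (simp add: ennreal_mult_less_top)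
      then show "bmo_norm M f < \<infinity>" using up[OF f] by (rule le_less_trans[rotated])
    qed
    then have "bmo M = bmo_phi \<phi> M" by (auto simp: bmo_def bmo_phi_def)
    then show "bmo M = bmo_phi \<phi> M \<and> (\<forall>f \<in> borel_measurable (completion M).
         ennreal (the_inv_into {0..} \<phi> 1) * bmo_phi_norm \<phi> M f \<le> bmo_norm M f \<and>
         bmo_norm M f \<le> ennreal (6 * A) * bmo_phi_norm \<phi> M f)"
      using low up by blast
  qed
qed

end
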